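(* Let $R$ be a commutative unital ring and let $A=R[t_1,\ldots,t_d]$ be the polynomial algebra with $d\geq 2$. For every integer $n\geq 2$, the morphism $$\Pi_n : A^{\otimes n}\longrightarrow \mathbb{M}\mathrm{Der}(A^{\otimes n},A^{\otimes n}),\qquad \Pi_n(\Theta)(a_1\otimes\cdots\otimes a_n)=\phi_n(a_1\otimes\cdots\otimes a_n)\,\Theta,$$ is an isomorphism of $R[\mathbb{Z}/n]$-modules.
   Context: All tensor products are over $R$. The symmetric group $\mathfrak{S}_n$ acts on $A^{\otimes n}$ by $\sigma(a_1\otimes\cdots\otimes a_n)=a_{\sigma^{-1}(1)}\otimes\cdots\otimes a_{\sigma^{-1}(n)}$ and on $\mathrm{Hom}_R(A^{\otimes n},A^{\otimes n})$ by $\sigma\cdot\phi=\sigma\circ\phi\circ\sigma^{-1}$. The cyclic group $\mathbb{Z}/n$ is regarded as the subgroup of $\mathfrak{S}_n$ generated by the cycle $(1\,2\,\cdots\,n)$, and acts by restriction. A map $\phi\in\mathrm{Hom}_R(A^{\otimes n},A^{\otimes n})$ is a derivation with respect to the last variable if, for all $a,b\in A$ and $\alpha\in A^{\otimes n-1}$, $\phi(\alpha\otimes ab)=(a\otimes 1^{\otimes n-1})\phi(\alpha\otimes b)+\phi(\alpha\otimes a)(1^{\otimes n-1}\otimes b)$, using the product of $A^{\otimes n}$. The $R$-module of multi-derivations $\mathbb{M}\mathrm{Der}(A^{\otimes n},A^{\otimes n})\subset\mathrm{Hom}_R(A^{\otimes n},A^{\otimes n})$ consists of those $\phi$ such that $\sigma\cdot\phi$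 is a derivation with respect to the last variable for every $\sigma\in\mathbb{Z}/n$; it is stable under the $\mathbb{Z}/n$-action. For $A$ commutative, $\phi_n\in\mathbb{M}\mathrm{Der}(A^{\otimes n},A^{\otimes n})$ is the $\mathbb{Z}/n$-equivariant multi-derivation $$\phi_n(a_1\otimes\cdots\otimes a_n):=\prod_{\sigma\in\mathbb{Z}/n}\sigma\big(a_{\sigma(n)}\otimes 1^{\otimes n-1}-1^{\otimes n-1}\otimes a_{\sigma(n)}\big),$$ the product being formed in $A^{\otimes n}$. *)

theory Defs
  imports "HOL-Algebra.Algebra" "HOL-Algebra.Algebraic_Closure_Type" "HOL-Library.Poly_Mapping"
begin

section \<open>The polynomial algebra and free modules\<close>

text \<open>
  \<^typ>\<open>'k \<Rightarrow>\<^sub>0 'r\<close> is the free module over the ring \<^typ>\<open>'r\<close> on the set of all elements of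
  \<^typ>\<open>'k\<close>. With exponent vectors as keys (added pointwise) the library's convolution product
  makes it the polynomial algebra; the number of variables is the cardinality of \<^typ>\<open>'v\<close>,
  which need not be finite in this theory.
\<close>

type_synonym ('v, 'r) mpoly = "('v \<Rightarrow>\<^sub>0 nat) \<Rightarrow>\<^sub>0 'r"

definition fsmult :: "'r::comm_ring_1 \<Rightarrow> ('k \<Rightarrow>\<^sub>0 'r) \<Rightarrow> ('k \<Rightarrow>\<^sub>0 'r)"
  where "fsmult c = Poly_Mapping.map ((*) c)"

lemma lookup_fsmult [simp]: "Poly_Mapping.lookup (fsmult c u) k = c * Poly_Mapping.lookup u k"
  by (simp add: fsmult_def Poly_Mapping.map.rep_eq when_def)

lemma fsmult_single [simp]:
  "fsmult c (Poly_Mapping.single k d) = Poly_Mapping.single k (c * d)"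
  by (rule poly_mapping_eqI) (simp add: lookup_single when_def)

global_interpretation free_module: Modules.module fsmult
  by unfold_locales (auto intro!: poly_mapping_eqI simp: lookup_add algebra_simps)


section \<open>Tensor powers\<close>

text \<open>
  All tensor powers of the polynomial algebra live in one type, the tensor algebra: the free module
  on words modulo the multilinearity relations. The relations are homogeneous in the length of
  words, so the span of the words of length \<open>n\<close> is the \<open>n\<close>-th tensor power.
\<close>

definition multilinear_relators :: "(('v, 'r::comm_ring_1) mpoly list \<Rightarrow>\<^sub>0 'r) set" where
  "multilinear_relators =
     {Poly_Mapping.single (xs @ (a + b) # ys) 1
        - Poly_Mapping.single (xs @ a # ys) 1 - Poly_Mapping.single (xs @ b # ys) 1
        | xs ys a b. True}
   \<union> {Poly_Mapping.single (xs @ fsmult c a # ys) 1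
        - fsmult c (Poly_Mapping.single (xs @ a # ys) 1)
        | xs ys a c. True}"

definition tensor_eq ::
    "(('v, 'r::comm_ring_1) mpoly list \<Rightarrow>\<^sub>0 'r) \<Rightarrow> (('v, 'r) mpoly list \<Rightarrow>\<^sub>0 'r) \<Rightarrow> bool"
  where "tensor_eq u v \<longleftrightarrow> u - v \<in> free_module.span multilinear_relators"

lemma equivp_tensor_eq: "equivp tensor_eq"
proof (rule equivpI)
  show "reflp tensor_eq"
    by (auto simp: reflp_def tensor_eq_def free_module.span_zero)
  show "symp tensor_eq"
    unfolding symp_def tensor_eq_def by (metis free_module.span_neg minus_diff_eq)
  show "transp tensor_eq"
    unfolding transp_def tensor_eq_def
    by (metis (no_types, opaque_lifting) diff_add_cancel add_diff_eq free_module.span_add)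
qed

quotient_type (overloaded) ('v, 'r) tensor =
  "('v, 'r::comm_ring_1) mpoly list \<Rightarrow>\<^sub>0 'r" / tensor_eq
  morphisms rep_tensor abs_tensor
  by (rule equivp_tensor_eq)

lemma tensor_eq_add: "tensor_eq u u' \<Longrightarrow> tensor_eq v v' \<Longrightarrow> tensor_eq (u + v) (u' + v')"
  unfolding tensor_eq_def by (drule (1) free_module.span_add) (simp add: algebra_simps)

lemma tensor_eq_uminus: "tensor_eq u u' \<Longrightarrow> tensor_eq (- u) (- u')"
  unfolding tensor_eq_def by (drule free_module.span_neg) (simp add: algebra_simps)

lemma tensor_eq_diff: "tensor_eq u u' \<Longrightarrow> tensor_eq v v' \<Longrightarrow> tensor_eq (u - v) (u' - v')"
  unfolding tensor_eq_def by (drule (1) free_module.span_diff) (simp add: algebra_simps)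

lemma tensor_eq_fsmult: "tensor_eq u u' \<Longrightarrow> tensor_eq (fsmult c u) (fsmult c u')"
  unfolding tensor_eq_def
  by (drule free_module.span_scale[of _ _ c]) (simp add: free_module.scale_right_diff_distrib)

instantiation tensor :: (type, comm_ring_1) ab_group_add
begin

lift_definition zero_tensor :: "('a, 'b) tensor" is 0 .
lift_definition plus_tensor :: "('a, 'b) tensor \<Rightarrow> ('a, 'b) tensor \<Rightarrow> ('a, 'b) tensor"
  is "(+)" by (rule tensor_eq_add)
lift_definition minus_tensor :: "('a, 'b) tensor \<Rightarrow> ('a, 'b) tensor \<Rightarrow> ('a, 'b) tensor"
  is "(-)" by (rule tensor_eq_diff)
lift_definition uminus_tensor :: "('a, 'b) tensor \<Rightarrow> ('a, 'b) tensor"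
  is uminus by (rule tensor_eq_uminus)

instance
proof
  fix a b c :: "('a, 'b) tensor"
  show "a + b + c = a + (b + c)"
    by transfer (simp add: tensor_eq_def add.assoc free_module.span_zero)
  show "a + b = b + a"
    by transfer (simp add: tensor_eq_def add.commute free_module.span_zero)
  show "0 + a = a"
    by transfer (simp add: tensor_eq_def free_module.span_zero)
  show "- a + a = 0"
    by transfer (simp add: tensor_eq_def free_module.span_zero)
  show "a - b = a + - b"
    by transfer (simp add: tensor_eq_def free_module.span_zero)
qed

end

lift_definition tsmult :: "'r::comm_ring_1 \<Rightarrow> ('v, 'r) tensor \<Rightarrow> ('v, 'r) tensor"
  is fsmult by (rule tensor_eq_fsmult)

definition pure_tensor :: "('v, 'r::comm_ring_1) mpoly list \<Rightarrow> ('v, 'r) tensor"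
  where "pure_tensor xs = abs_tensor (Poly_Mapping.single xs 1)"

global_interpretation tensor: Modules.module tsmult
  by unfold_locales
     (transfer; simp add: tensor_eq_def free_module.span_zero
        free_module.scale_right_distrib free_module.scale_left_distrib)+

lemma pure_tensor_add: "pure_tensor (xs @ (a + b) # ys) = pure_tensor (xs @ a # ys) + pure_tensor (xs @ b # ys)"
proof -
  have "Poly_Mapping.single (xs @ (a + b) # ys) 1
        - Poly_Mapping.single (xs @ a # ys) 1 - Poly_Mapping.single (xs @ b # ys) 1 \<in> free_module.span multilinear_relators"
    by (rule free_module.span_base) (auto simp: multilinear_relators_def)
  then show ?thesis
    by (simp add: pure_tensor_def plus_tensor.abs_eq tensor.abs_eq_iff tensor_eq_def diff_diff_eq)
qed

lemma pure_tensor_scale: "pure_tensor (xs @ fsmult c a # ys) = tsmult c (pure_tensor (xs @ a # ys))"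
proof -
  have "Poly_Mapping.single (xs @ fsmult c a # ys) 1
        - fsmult c (Poly_Mapping.single (xs @ a # ys) 1) \<in> free_module.span multilinear_relators"
    by (rule free_module.span_base) (unfold multilinear_relators_def, blast)
  then show ?thesis
    by (simp add: pure_tensor_def tsmult.abs_eq tensor.abs_eq_iff tensor_eq_def)
qed

definition tensor_space :: "nat \<Rightarrow> ('v, 'r::comm_ring_1) tensor set"
  where "tensor_space n = tensor.span (pure_tensor ` {xs. length xs = n})"

text \<open>
  The map out of the \<open>n\<close>-th tensor power induced by a function \<open>f\<close> of \<open>n\<close> arguments. The definition
  computes with a representative; \<open>tensor_lift_pure\<close>, \<open>tensor_lift_add\<close> and \<open>tensor_lift_scale\<close>
  show that it is the universal linear extension whenever \<open>f\<close> is multilinear.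
\<close>

definition multilinear :: "nat \<Rightarrow> (('v, 'r::comm_ring_1) mpoly list \<Rightarrow> ('v, 'r) tensor) \<Rightarrow> bool"
  where "multilinear n f \<longleftrightarrow>
    (\<forall>xs ys a b. Suc (length xs + length ys) = n \<longrightarrow>
       f (xs @ (a + b) # ys) = f (xs @ a # ys) + f (xs @ b # ys)) \<and>
    (\<forall>xs ys a c. Suc (length xs + length ys) = n \<longrightarrow>
       f (xs @ fsmult c a # ys) = tsmult c (f (xs @ a # ys)))"

definition free_extension ::
    "nat \<Rightarrow> (('v, 'r::comm_ring_1) mpoly list \<Rightarrow> ('v, 'r) tensor)
      \<Rightarrow> (('v, 'r) mpoly list \<Rightarrow>\<^sub>0 'r) \<Rightarrow> ('v, 'r) tensor"
  where "free_extension n f u =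
    (\<Sum>xs \<in> {xs \<in> Poly_Mapping.keys u. length xs = n}. tsmult (Poly_Mapping.lookup u xs) (f xs))"

definition tensor_lift ::
    "nat \<Rightarrow> (('v, 'r::comm_ring_1) mpoly list \<Rightarrow> ('v, 'r) tensor) \<Rightarrow> ('v, 'r) tensor \<Rightarrow> ('v, 'r) tensor"
  where "tensor_lift n f t = free_extension n f (rep_tensor t)"

lemma free_extension_superset:
  assumes "finite S" "Poly_Mapping.keys u \<subseteq> S"
  shows "free_extension n f u =
    (\<Sum>xs \<in> S. if length xs = n then tsmult (Poly_Mapping.lookup u xs) (f xs) else 0)"
proof -
  have "free_extension n f u =
      (\<Sum>xs \<in> Poly_Mapping.keys u. if length xs = n then tsmult (Poly_Mapping.lookup u xs) (f xs) else 0)"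
    unfolding free_extension_def
    by (simp flip: sum.inter_filter)
  also have "\<dots> = (\<Sum>xs \<in> S. if length xs = n then tsmult (Poly_Mapping.lookup u xs) (f xs) else 0)"
    using assms by (intro sum.mono_neutral_left) (auto simp: in_keys_iff)
  finally show ?thesis .
qed

lemma free_extension_add:
  "free_extension n f (u + v) = free_extension n f u + free_extension n f v"
proof -
  let ?S = "Poly_Mapping.keys u \<union> Poly_Mapping.keys v"
  have "finite ?S" "Poly_Mapping.keys (u + v) \<subseteq> ?S"
    using Poly_Mapping.keys_add[of u v] by auto
  then show ?thesis
    by (simp add: free_extension_superset[where S = ?S] lookup_add tensor.scale_left_distrib
        sum.distrib[symmetric] if_distrib cong: if_cong)
qed

lemma free_extension_fsmult:
  "free_extension n f (fsmult c u) = tsmult c (free_extension n f u)"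
proof -
  let ?S = "Poly_Mapping.keys u"
  have "finite ?S" "Poly_Mapping.keys (fsmult c u) \<subseteq> ?S"
    by (auto simp: in_keys_iff)
  then show ?thesis
    by (auto simp: free_extension_superset[where S = ?S] tensor.scale_sum_right intro!: sum.cong)
qed

lemma free_extension_single:
  "free_extension n f (Poly_Mapping.single xs c) = (if length xs = n then tsmult c (f xs) else 0)"
  by (subst free_extension_superset[where S = "{xs}"]) auto

lemma free_extension_diff:
  "free_extension n f (u - v) = free_extension n f u - free_extension n f v"
  using free_extension_add[of n f "u - v" v] by simp

lemma free_extension_relators:
  assumes "multilinear n f" "u \<in> free_module.span multilinear_relators"
  shows "free_extension n f u = 0"
  using assms(2)
proof (induction rule: free_module.span_induct_alt)
  case base
  show ?case by (simp add: free_extension_def)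
next
  case (step c r v)
  have "free_extension n f r = 0"
    using step.hyps assms(1) unfolding multilinear_relators_def multilinear_def
    by (auto simp: free_extension_diff free_extension_single)
  then show ?case
    using step by (simp add: free_extension_add free_extension_fsmult)
qed

lemma tensor_lift_abs:
  assumes "multilinear n f"
  shows "tensor_lift n f (abs_tensor u) = free_extension n f u"
proof -
  have "tensor_eq (rep_tensor (abs_tensor u)) u"
    by (metis Quotient3_tensor Quotient3_rep_abs equivp_reflp equivp_tensor_eq)
  then show ?thesis
    using free_extension_relators[OF assms] free_extension_diff
    unfolding tensor_lift_def tensor_eq_def by (metis eq_iff_diff_eq_0)
qed

lemma tensor_abs_cases: obtains u where "t = abs_tensor u"
  by (metis Quotient3_abs_rep Quotient3_tensor)

lemma tensor_lift_pure:
  assumes "multilinear n f" "length xs = n"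
  shows "tensor_lift n f (pure_tensor xs) = f xs"
  using assms by (simp add: pure_tensor_def tensor_lift_abs free_extension_single)

lemma tensor_lift_add:
  assumes "multilinear n f"
  shows "tensor_lift n f (s + t) = tensor_lift n f s + tensor_lift n f t"
  using assms by (cases s rule: tensor_abs_cases, cases t rule: tensor_abs_cases)
    (simp add: plus_tensor.abs_eq tensor_lift_abs free_extension_add)

lemma tensor_lift_scale:
  assumes "multilinear n f"
  shows "tensor_lift n f (tsmult c t) = tsmult c (tensor_lift n f t)"
  using assms by (cases t rule: tensor_abs_cases)
    (simp add: tsmult.abs_eq tensor_lift_abs free_extension_fsmult)

definition tensor_mult ::
    "nat \<Rightarrow> ('v, 'r::comm_ring_1) tensor \<Rightarrow> ('v, 'r) tensor \<Rightarrow> ('v, 'r) tensor"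
  where "tensor_mult n s t =
    tensor_lift n (\<lambda>xs. tensor_lift n (\<lambda>ys. pure_tensor (map2 (*) xs ys)) t) s"

lemma fsmult_eq_times: "fsmult c p = Poly_Mapping.single 0 c * (p :: ('v,'r::comm_ring_1) mpoly)"
proof -
  have "Poly_Mapping.lookup (Poly_Mapping.single 0 c * p) k = c * Poly_Mapping.lookup p k" for k
  proof (induction p arbitrary: k rule: update_induct)
    case (const) then show ?case by simp
  next
    case (update f a b)
    have "Poly_Mapping.update a b f = Poly_Mapping.single a b + f"
      using update by (intro poly_mapping_eqI) (auto simp: lookup_update lookup_add lookup_single when_def in_keys_iff)
    then show ?case using update by (simp add: distrib_left lookup_add mult_single lookup_single when_def)
  qed
  then show ?thesis by (intro poly_mapping_eqI) simp
qed

lemma multilinear_map2: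
  fixes xs :: "('v, 'r::comm_ring_1) mpoly list"
  assumes "length xs = n"
  shows "multilinear n (\<lambda>ys. pure_tensor (map2 (*) xs ys))"
proof -
  have *: "\<exists>us z vs. \<forall>a. map2 (*) xs (ps @ a # qs) = us @ (z * a) # vs"
    if "Suc (length ps + length qs) = n" for ps qs :: "('v, 'r) mpoly list"
  proof (intro exI allI)
    fix a
    have "xs = take (length ps) xs @ xs ! length ps # drop (Suc (length ps)) xs"
      using that assms by (simp add: id_take_nth_drop[symmetric])
    then have "map2 (*) xs (ps @ a # qs) =
        map2 (*) (take (length ps) xs @ xs ! length ps # drop (Suc (length ps)) xs) (ps @ a # qs)"
      by simp
    also have "\<dots> = map2 (*) (take (length ps) xs) ps
        @ (xs ! length ps * a) # map2 (*) (drop (Suc (length ps)) xs) qs"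
      using that assms by (subst zip_append) simp_all
    finally show "map2 (*) xs (ps @ a # qs) = map2 (*) (take (length ps) xs) ps
        @ (xs ! length ps * a) # map2 (*) (drop (Suc (length ps)) xs) qs" .
  qed
  have scale: "z * fsmult c a = fsmult c (z * a)" for z a :: "('v, 'r) mpoly" and c
    by (simp add: fsmult_eq_times mult_ac)
  show ?thesis
    unfolding multilinear_def
  proof (intro conjI allI impI)
    fix ps qs :: "('v, 'r) mpoly list" and a b :: "('v, 'r) mpoly"
    assume "Suc (length ps + length qs) = n"
    from *[OF this] obtain us z vs
      where "\<And>a. map2 (*) xs (ps @ a # qs) = us @ (z * a) # vs" by blast
    then show "pure_tensor (map2 (*) xs (ps @ (a + b) # qs)) =
        pure_tensor (map2 (*) xs (ps @ a # qs)) + pure_tensor (map2 (*) xs (ps @ b # qs))"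
      by (simp only: distrib_left pure_tensor_add)
  next
    fix ps qs :: "('v, 'r) mpoly list" and a :: "('v, 'r) mpoly" and c
    assume "Suc (length ps + length qs) = n"
    from *[OF this] obtain us z vs
      where "\<And>a. map2 (*) xs (ps @ a # qs) = us @ (z * a) # vs" by blast
    then show "pure_tensor (map2 (*) xs (ps @ fsmult c a # qs)) =
        tsmult c (pure_tensor (map2 (*) xs (ps @ a # qs)))"
      by (simp only: scale pure_tensor_scale)
  qed
qed

lemma tensor_mult_pure:
  fixes xs :: "('v, 'r::comm_ring_1) mpoly list"
  assumes "length xs = n" "length ys = n"
  shows "tensor_mult n (pure_tensor xs) (pure_tensor ys) = pure_tensor (map2 (*) xs ys)"
proof -
  have comm: "map2 (*) xs ys = map2 (*) ys xs" for xs ys :: "('v,'r) mpoly list"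
    by (subst zip_commute) (simp add: case_prod_unfold mult.commute comp_def)
  have "multilinear n (\<lambda>xs. tensor_lift n (\<lambda>ys. pure_tensor (map2 (*) xs ys)) (pure_tensor ys))"
    using multilinear_map2[OF assms(2)] tensor_lift_pure[OF multilinear_map2 assms(2)] unfolding multilinear_def
    by (simp add: comm[of _ ys])
  then show ?thesis unfolding tensor_mult_def using assms tensor_lift_pure[OF multilinear_map2 assms(2)]
    by (simp add: tensor_lift_pure)
qed

definition tensor_power :: "nat \<Rightarrow> ('r::comm_ring_1, ('v, 'r) tensor) module" where
  "tensor_power n =
    \<lparr>carrier = tensor_space n, monoid.mult = tensor_mult n, one = pure_tensor (replicate n 1),
     ring.zero = 0, add = (+), module.smult = tsmult\<rparr>"

text \<open>The map taking \<open>\<alpha>\<close> in the \<open>m\<close>-th tensor power to \<open>\<alpha> \<otimes> a\<close> in the next one.\<close>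

definition tensor_snoc ::
    "nat \<Rightarrow> ('v, 'r::comm_ring_1) tensor \<Rightarrow> ('v, 'r) mpoly \<Rightarrow> ('v, 'r) tensor"
  where "tensor_snoc m \<alpha> a = tensor_lift m (\<lambda>xs. pure_tensor (xs @ [a])) \<alpha>"

lemma tensor_snoc_pure: "length xs = m \<Longrightarrow> tensor_snoc m (pure_tensor xs) a = pure_tensor (xs @ [a])"
  unfolding tensor_snoc_def by (rule tensor_lift_pure) (auto simp: multilinear_def pure_tensor_add pure_tensor_scale)

text \<open>Permutations act on the index set \<open>{1..n}\<close>, while list positions start at 0.\<close>

definition sym_action ::
    "nat \<Rightarrow> (nat \<Rightarrow> nat) \<Rightarrow> ('v, 'r::comm_ring_1) tensor \<Rightarrow> ('v, 'r) tensor"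
  where "sym_action n \<sigma> =
    tensor_lift n (\<lambda>xs. pure_tensor (map (\<lambda>i. xs ! (inv' \<sigma> i - 1)) [1..<Suc n]))"

lemma sym_action_pure:
  fixes xs :: "('v, 'r::comm_ring_1) mpoly list"
  assumes s: "\<sigma> permutes {1..n}" and "length xs = n"
  shows "sym_action n \<sigma> (pure_tensor xs) = pure_tensor (map (\<lambda>i. xs ! (inv' \<sigma> i - 1)) [1..<Suc n])"
proof -
  let ?p = "\<lambda>xs :: ('v,'r) mpoly list. map (\<lambda>i. xs ! (inv' \<sigma> i - 1)) [1..<Suc n]"
  have *: "\<exists>us vs. \<forall>a. ?p (ps @ a # qs) = us @ a # vs" if l: "Suc (length ps + length qs) = n" for ps qs
  proof -
    let ?k = "\<sigma> (Suc (length ps))"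
    have k: "?k \<in> {1..n}" using permutes_in_image[OF s, of "Suc (length ps)"] l by simp
    have sp: "[1..<Suc n] = [1..<?k] @ ?k # [Suc ?k..<Suc n]"
      using k upt_add_eq_append[of 1 ?k "Suc n - ?k"] upt_conv_Cons[of ?k "Suc n"] by (simp del: upt_Suc)
    have e: "(ps @ a # qs) ! (inv' \<sigma> i - 1) = (ps @ 0 # qs) ! (inv' \<sigma> i - 1)" if "i \<noteq> ?k" "1 \<le> i" "i \<le> n" for a i
    proof -
      have "inv' \<sigma> i \<noteq> Suc (length ps)" using that(1) permutes_inverses[OF s] by metis
      moreover have "inv' \<sigma> i \<in> {1..n}" using that permutes_in_image[OF permutes_inv[OF s], of i] by simp
      ultimately show ?thesis by (auto simp: nth_append nth_Cons')
    qed
    have "?p (ps @ a # qs) = map (\<lambda>i. (ps @ 0 # qs) ! (inv' \<sigma> i - 1)) [1..<?k] @ a # map (\<lambda>i. (ps @ 0 # qs) ! (inv' \<sigma> i - 1)) [Suc ?k..<Suc n]" for a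
      unfolding sp using k by (auto intro!: e[simplified] simp: permutes_inverses[OF s] simp del: upt_Suc)
    then show ?thesis by blast
  qed
  have "multilinear n (\<lambda>xs. pure_tensor (?p xs))"
    unfolding multilinear_def
  proof (intro conjI allI impI)
    fix ps qs :: "('v, 'r) mpoly list" and a b :: "('v, 'r) mpoly"
    assume "Suc (length ps + length qs) = n"
    from *[OF this] obtain us vs where "\<And>a. ?p (ps @ a # qs) = us @ a # vs" by blast
    then show "pure_tensor (?p (ps @ (a + b) # qs)) =
        pure_tensor (?p (ps @ a # qs)) + pure_tensor (?p (ps @ b # qs))"
      by (simp only: pure_tensor_add)
  next
    fix ps qs :: "('v, 'r) mpoly list" and a :: "('v, 'r) mpoly" and c
    assume "Suc (length ps + length qs) = n"
    from *[OF this] obtain us vs where "\<And>a. ?p (ps @ a # qs) = us @ a # vs" by blast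
    then show "pure_tensor (?p (ps @ fsmult c a # qs)) = tsmult c (pure_tensor (?p (ps @ a # qs)))"
      by (simp only: pure_tensor_scale)
  qed
  then show ?thesis unfolding sym_action_def using assms by (simp add: tensor_lift_pure del: upt_Suc)
qed


section \<open>Modules with a linear group action\<close>

text \<open>
  An \<open>R[G]\<close>-module is an \<open>R\<close>-module on which \<open>G\<close> acts by \<open>R\<close>-linear maps, and a morphism of
  \<open>R[G]\<close>-modules is a \<open>G\<close>-equivariant \<open>R\<close>-linear map. Linear maps are extensional functions,
  so that two of them are equal as soon as they agree on the carrier.
\<close>

definition linear_maps ::
    "('r, 'k) ring_scheme \<Rightarrow> ('r, 'm, 'i) module_scheme \<Rightarrow> ('r, 'n, 'j) module_scheme
      \<Rightarrow> ('m \<Rightarrow> 'n) set"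
  where "linear_maps R M N =
    {f \<in> carrier M \<rightarrow>\<^sub>E carrier N.
       (\<forall>x\<in>carrier M. \<forall>y\<in>carrier M. f (x \<oplus>\<^bsub>M\<^esub> y) = f x \<oplus>\<^bsub>N\<^esub> f y) \<and>
       (\<forall>c\<in>carrier R. \<forall>x\<in>carrier M. f (c \<odot>\<^bsub>M\<^esub> x) = c \<odot>\<^bsub>N\<^esub> f x)}"

text \<open>A module record has ring fields that play no role for a mere module; they stay unspecified.\<close>

definition hom_module ::
    "('r, 'k) ring_scheme \<Rightarrow> ('r, 'm, 'i) module_scheme \<Rightarrow> ('r, 'n, 'j) module_scheme
      \<Rightarrow> ('r, 'm \<Rightarrow> 'n) module"
  where "hom_module R M N =
    \<lparr>carrier = linear_maps R M N, monoid.mult = undefined, one = undefined,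
     ring.zero = (\<lambda>x\<in>carrier M. \<zero>\<^bsub>N\<^esub>), add = (\<lambda>f g. \<lambda>x\<in>carrier M. f x \<oplus>\<^bsub>N\<^esub> g x),
     module.smult = (\<lambda>c f. \<lambda>x\<in>carrier M. c \<odot>\<^bsub>N\<^esub> f x)\<rparr>"

definition group_module ::
    "('r, 'k) ring_scheme \<Rightarrow> ('g, 'h) monoid_scheme \<Rightarrow> ('r, 'm, 'i) module_scheme
      \<Rightarrow> ('g \<Rightarrow> 'm \<Rightarrow> 'm) \<Rightarrow> bool"
  where "group_module R G M \<rho> \<longleftrightarrow>
    module R M \<and>
    group_action G (carrier M) (\<lambda>g. restrict (\<rho> g) (carrier M)) \<and>
    (\<forall>g\<in>carrier G. restrict (\<rho> g) (carrier M) \<in> linear_maps R M M)"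

definition group_module_iso ::
    "('r, 'k) ring_scheme \<Rightarrow> ('g, 'h) monoid_scheme
      \<Rightarrow> ('r, 'm, 'i) module_scheme \<Rightarrow> ('g \<Rightarrow> 'm \<Rightarrow> 'm)
      \<Rightarrow> ('r, 'n, 'j) module_scheme \<Rightarrow> ('g \<Rightarrow> 'n \<Rightarrow> 'n) \<Rightarrow> ('m \<Rightarrow> 'n) \<Rightarrow> bool"
  where "group_module_iso R G M \<rho> N \<tau> f \<longleftrightarrow>
    group_module R G M \<rho> \<and> group_module R G N \<tau> \<and>
    f \<in> linear_maps R M N \<and> bij_betw f (carrier M) (carrier N) \<and>
    (\<forall>g\<in>carrier G. \<forall>x\<in>carrier M. f (\<rho> g x) = \<tau> g (f x))"


section \<open>Multi-derivations\<close>

definition cyclic_perm_group :: "nat \<Rightarrow> (nat \<Rightarrow> nat) monoid"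
  where "cyclic_perm_group n =
    (sym_group n)\<lparr>carrier := generate (sym_group n) {cycle_of_list [1..<Suc n]}\<rparr>"

definition tensor_end :: "nat \<Rightarrow> ('r::comm_ring_1, ('v, 'r) tensor \<Rightarrow> ('v, 'r) tensor) module"
  where "tensor_end n = hom_module ring_of_type_algebra (tensor_power n) (tensor_power n)"

definition conj_action ::
    "nat \<Rightarrow> (nat \<Rightarrow> nat) \<Rightarrow> (('v, 'r::comm_ring_1) tensor \<Rightarrow> ('v, 'r) tensor)
      \<Rightarrow> (('v, 'r) tensor \<Rightarrow> ('v, 'r) tensor)"
  where "conj_action n \<sigma> \<phi> =
    (\<lambda>t\<in>tensor_space n. sym_action n \<sigma> (\<phi> (sym_action n (inv' \<sigma>) t)))"

definition in_first_slot :: "nat \<Rightarrow> ('v, 'r::comm_ring_1) mpoly \<Rightarrow> ('v, 'r) tensor"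
  where "in_first_slot n a = pure_tensor (a # replicate (n - 1) 1)"

definition in_last_slot :: "nat \<Rightarrow> ('v, 'r::comm_ring_1) mpoly \<Rightarrow> ('v, 'r) tensor"
  where "in_last_slot n a = pure_tensor (replicate (n - 1) 1 @ [a])"

definition derivation_in_last ::
    "nat \<Rightarrow> (('v, 'r::comm_ring_1) tensor \<Rightarrow> ('v, 'r) tensor) \<Rightarrow> bool"
  where "derivation_in_last n \<phi> \<longleftrightarrow>
    (\<forall>a b. \<forall>\<alpha>\<in>tensor_space (n - 1).
       \<phi> (tensor_snoc (n - 1) \<alpha> (a * b)) =
         in_first_slot n a \<otimes>\<^bsub>tensor_power n\<^esub> \<phi> (tensor_snoc (n - 1) \<alpha> b)
         \<oplus>\<^bsub>tensor_power n\<^esub> \<phi> (tensor_snoc (n - 1) \<alpha> a) \<otimes>\<^bsub>tensor_power n\<^esub> in_last_slot n b)"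

definition multi_derivations ::
    "nat \<Rightarrow> ('r::comm_ring_1, ('v, 'r) tensor \<Rightarrow> ('v, 'r) tensor) module"
  where "multi_derivations n = (tensor_end n)
    \<lparr>carrier := {\<phi> \<in> carrier (tensor_end n).
       \<forall>\<sigma>\<in>carrier (cyclic_perm_group n). derivation_in_last n (conj_action n \<sigma> \<phi>)}\<rparr>"

text \<open>
  The lifted function is multilinear: \<open>\<sigma> \<mapsto> \<sigma> n\<close> is a bijection from the cyclic group onto \<open>{1..n}\<close>, so
  each argument enters exactly one factor, and linearly.
\<close>

definition phi_map :: "nat \<Rightarrow> ('v, 'r::comm_ring_1) tensor \<Rightarrow> ('v, 'r) tensor"
  where "phi_map n = tensor_lift n (\<lambda>as.
    \<Otimes>\<^bsub>tensor_power n\<^esub>\<sigma>\<in>carrier (cyclic_perm_group n).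
      sym_action n \<sigma> (in_first_slot n (as ! (\<sigma> n - 1)) - in_last_slot n (as ! (\<sigma> n - 1))))"

definition Pi_map ::
    "nat \<Rightarrow> ('v, 'r::comm_ring_1) tensor \<Rightarrow> (('v, 'r) tensor \<Rightarrow> ('v, 'r) tensor)"
  where "Pi_map n = (\<lambda>\<Theta>\<in>tensor_space n. \<lambda>t\<in>tensor_space n. phi_map n t \<otimes>\<^bsub>tensor_power n\<^esub> \<Theta>)"

end

theory Submission
  imports Defs
begin

text \<open>
  Write \<open>c\<close> for the cycle \<open>j \<mapsto> j + 1\<close> on \<open>{1..n}\<close> and \<open>a\<^sup>(\<^sup>j\<^sup>)\<close> for \<open>a\<close> placed in the \<open>j\<close>-th slot of the
  tensor power. The tensor power of a polynomial ring is itself a polynomial ring, with one copy of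
  the variables for each slot: \<open>poly_of\<close> embeds it into the polynomials in variables tagged by slots,
  and \<open>tensor_of\<close> is a multiplicative left inverse (\<open>tensor_of_poly_of\<close>, \<open>tensor_of_mult\<close>). Products,
  the permutation action and the equivariant multi-derivation are all computed there, and
  \<open>\<phi>\<^sub>n(a\<^sub>1 \<otimes> \<dots> \<otimes> a\<^sub>n)\<close> becomes the product of the differences \<open>D\<^sub>j(a\<^sub>j)\<close> with
  \<open>D\<^sub>j(a) = a\<^sup>(\<^sup>c\<^sup>j\<^sup>) - a\<^sup>(\<^sup>j\<^sup>)\<close> (\<open>poly_of_phi_map\<close>).

  Conjugating by the cyclic group moves the derivation rule from the last argument to every argument:
  in the \<open>j\<close>-th one a multi-derivation satisfies
  \<open>f(ab) = a\<^sup>(\<^sup>c\<^sup>j\<^sup>) f(b) + f(a) b\<^sup>(\<^sup>j\<^sup>)\<close> (\<open>multi_derivation_product\<close>). Since \<open>A\<close> is commutative, comparing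
  \<open>f(ab)\<close> with \<open>f(ba)\<close> gives \<open>D\<^sub>j(a) f(b) = D\<^sub>j(b) f(a)\<close>. Doing this in all slots yields
  \<open>\<Prod>D\<^sub>j(b\<^sub>j) \<cdot> \<phi>(a\<^sub>1, \<dots>, a\<^sub>n) = \<Prod>D\<^sub>j(a\<^sub>j) \<cdot> \<phi>(b\<^sub>1, \<dots>, b\<^sub>n)\<close> (\<open>multi_derivation_exchange\<close>).

  Now use two variables \<open>x \<noteq> y\<close>. Exchanging \<open>(x, \<dots>, x)\<close> with \<open>(y, \<dots>, y)\<close> shows that \<open>\<Prod>D\<^sub>j(x)\<close> divides
  \<open>\<Prod>D\<^sub>j(y) \<cdot> \<phi>(x, \<dots>, x)\<close>. A difference of two distinct variables is not a zero divisor, over any \<open>R\<close>;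
  this applies to \<open>D\<^sub>j(x)\<close> because \<open>c j \<noteq> j\<close> for \<open>n \<ge> 2\<close>. Moreover a factor \<open>D\<^sub>k(y)\<close> remains regular
  modulo \<open>D\<^sub>j(x)\<close>, since killing \<open>D\<^sub>j(x)\<close> only identifies two \<open>x\<close>-variables
  (\<open>Var_diff_nonzero_divisor\<close>, \<open>Var_diff_dvd_cancel\<close>). Hence \<open>\<phi>(x, \<dots>, x) = \<Prod>D\<^sub>j(x) \<cdot> \<Theta>\<close> for some \<open>\<Theta>\<close>. Exchanging \<open>(a\<^sub>1, \<dots>, a\<^sub>n)\<close> with
  \<open>(x, \<dots>, x)\<close> and cancelling \<open>\<Prod>D\<^sub>j(x)\<close> gives \<open>\<phi> = \<phi>\<^sub>n \<cdot> \<Theta>\<close> everywhere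
  (\<open>multi_derivation_eq_Pi_map\<close>), and the same cancellation shows that \<open>\<Theta>\<close> is unique
  (\<open>Pi_map_inj\<close>).
\<close>

section \<open>Additive extensions and renaming of variables\<close>

definition add_ext :: "('k \<Rightarrow> 'c \<Rightarrow> 'm) \<Rightarrow> ('k \<Rightarrow>\<^sub>0 'c::zero) \<Rightarrow> 'm::comm_monoid_add"
  where "add_ext g u = (\<Sum>k\<in>Poly_Mapping.keys u. g k (Poly_Mapping.lookup u k))"

lemma add_ext_zero [simp]: "add_ext g 0 = 0"
  by (simp add: add_ext_def)

lemma add_ext_single:
  assumes "\<And>k. g k 0 = 0"
  shows "add_ext g (Poly_Mapping.single k c) = g k c"
  using assms by (simp add: add_ext_def)

lemma add_ext_add:
  fixes u v :: "'k \<Rightarrow>\<^sub>0 'c::monoid_add"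
  assumes "\<And>k. g k 0 = 0" "\<And>k a b. g k (a + b) = g k a + g k b"
  shows "add_ext g (u + v) = add_ext g u + add_ext g v"
  unfolding add_ext_def by (rule setsum_keys_plus_distrib) (use assms in auto)

lemma poly_mapping_induct [case_names zero single add]:
  fixes u :: "'k \<Rightarrow>\<^sub>0 'c::comm_monoid_add"
  assumes "P 0" "\<And>k c. P (Poly_Mapping.single k c)" "\<And>u v. P u \<Longrightarrow> P v \<Longrightarrow> P (u + v)"
  shows "P u"
proof (induction u rule: update_induct)
  case const then show ?case by (rule assms(1))
next
  case (update f a b)
  have "Poly_Mapping.update a b f = Poly_Mapping.single a b + f"
    using update by (intro poly_mapping_eqI) (auto simp: lookup_update lookup_add lookup_single when_def in_keys_iff)
  then show ?case using update assms by simp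
qed

text \<open>
  Transport of coefficients along a map of keys. On exponent vectors it renames variables; on
  polynomials it is the linear map that sends monomials to monomials. Both uses together give
  renaming of variables in a polynomial.
\<close>

definition push :: "('k \<Rightarrow> 'l) \<Rightarrow> ('k \<Rightarrow>\<^sub>0 'c::comm_monoid_add) \<Rightarrow> ('l \<Rightarrow>\<^sub>0 'c)"
  where "push h = add_ext (\<lambda>k. Poly_Mapping.single (h k))"

lemma push_zero [simp]: "push h 0 = 0"
  by (simp add: push_def)

lemma push_single [simp]: "push h (Poly_Mapping.single k c) = Poly_Mapping.single (h k) c"
  by (simp add: push_def add_ext_single)

lemma push_add: "push h (u + v) = push h u + push h v"
  unfolding push_def by (rule add_ext_add) (simp_all add: single_add)

lemma push_push: "push g (push h u) = push (g \<circ> h) u"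
  by (induction u rule: poly_mapping_induct) (simp_all add: push_add)

lemma push_mult:
  fixes u v :: "'k::comm_monoid_add \<Rightarrow>\<^sub>0 'c::comm_semiring_1"
  assumes "\<And>k l. h (k + l) = h k + h l"
  shows "push h (u * v) = push h u * push h v"
proof (induction u rule: poly_mapping_induct)
  case (single k c)
  show ?case
    by (induction v rule: poly_mapping_induct)
       (simp_all add: push_add distrib_left mult_single assms)
qed (simp_all add: push_add distrib_right)

definition ren :: "('v \<Rightarrow> 'w) \<Rightarrow> ('v, 'r::comm_ring_1) mpoly \<Rightarrow> ('w, 'r) mpoly"
  where "ren h = push (push h)"

lemma ren_zero [simp]: "ren h 0 = 0"
  by (simp add: ren_def)

lemma ren_add: "ren h (p + q) = ren h p + ren h q"
  by (simp add: ren_def push_add)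

lemma ren_diff: "ren h (p - q) = ren h p - ren h q"
  using ren_add[of h "p - q" q] by simp

lemma ren_mult: "ren h (p * q) = ren h p * ren h q"
  by (simp add: ren_def push_mult push_add)

lemma ren_one [simp]: "ren h 1 = 1"
  by (simp add: ren_def flip: single_one)

lemma ren_prod: "ren h (prod f S) = (\<Prod>i\<in>S. ren h (f i))"
  by (induction S rule: infinite_finite_induct) (simp_all add: ren_mult)

lemma ren_fsmult: "ren h (fsmult c p) = fsmult c (ren h p)"
  by (simp add: fsmult_eq_times ren_mult) (simp add: ren_def)

lemma ren_ren: "ren g (ren h p) = ren (g \<circ> h) p"
  by (simp add: ren_def push_push comp_def)

lemma ren_id: "ren id p = p"
proof (induction p rule: poly_mapping_induct)
  case (single k c)
  have "push id k = k" by (induction k rule: poly_mapping_induct) (simp_all only: push_zero push_single push_add id_apply)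
  then show ?case by (simp only: ren_def push_single)
qed (simp_all add: ren_add)

lemma ren_single: "ren h (Poly_Mapping.single m c) = Poly_Mapping.single (push h m) c"
  by (simp add: ren_def)

section \<open>Differences of two variables\<close>

abbreviation Var :: "'v \<Rightarrow> ('v, 'r::comm_ring_1) mpoly"
  where "Var u \<equiv> Poly_Mapping.single (Poly_Mapping.single u (Suc 0)) 1"

lemma lookup_single_times:
  fixes f :: "('k::{comm_monoid_add, cancel_ab_semigroup_add}) \<Rightarrow>\<^sub>0 'r::comm_ring_1"
  shows "Poly_Mapping.lookup (Poly_Mapping.single m c * f) (m + k) = c * Poly_Mapping.lookup f k"
  by (induction f rule: poly_mapping_induct)
     (simp_all add: distrib_left lookup_add mult_single lookup_single when_def)

lemma keys_single_times:
  fixes f :: "('k::comm_monoid_add) \<Rightarrow>\<^sub>0 'r::comm_ring_1"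
  assumes "Poly_Mapping.lookup (Poly_Mapping.single m c * f) l \<noteq> 0"
  obtains k where "l = m + k" "Poly_Mapping.lookup f k \<noteq> 0"
  using assms keys_mult[of "Poly_Mapping.single m c" f]
  by (force simp: in_keys_iff lookup_single when_def split: if_splits)

text \<open>
  Look at a monomial of \<open>f\<close> with the largest exponent of \<open>u\<close>. In \<open>u f\<close> it produces a monomial whose
  \<open>u\<close>-exponent is too large to occur in \<open>v f\<close>. The coefficient ring may have zero divisors, because
  the monomials \<open>u\<close> and \<open>v\<close> have coefficient 1.
\<close>

lemma Var_diff_nonzero_divisor:
  fixes f :: "('v, 'r::comm_ring_1) mpoly"
  assumes "u \<noteq> v" "(Var u - Var v) * f = 0"
  shows "f = 0"
proof (rule ccontr)
  assume "f \<noteq> 0"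
  then have ne: "Poly_Mapping.keys f \<noteq> {}" by simp
  define N where "N = Max ((\<lambda>k. Poly_Mapping.lookup k u) ` Poly_Mapping.keys f)"
  have "N \<in> (\<lambda>k. Poly_Mapping.lookup k u) ` Poly_Mapping.keys f"
    unfolding N_def using ne by (intro Max_in) auto
  then obtain k where k: "k \<in> Poly_Mapping.keys f" "Poly_Mapping.lookup k u = N" by auto
  have le: "Poly_Mapping.lookup l u \<le> N" if "l \<in> Poly_Mapping.keys f" for l
    unfolding N_def using that by (intro Max_ge) auto
  have eq: "Var u * f = Var v * f" using assms(2) by (simp add: left_diff_distrib)
  have "Poly_Mapping.lookup (Var u * f) (Poly_Mapping.single u (Suc 0) + k) \<noteq> 0"
    using k by (simp add: lookup_single_times in_keys_iff)
  then have "Poly_Mapping.lookup (Var v * f) (Poly_Mapping.single u (Suc 0) + k) \<noteq> 0"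
    by (simp add: eq)
  then obtain l where l: "Poly_Mapping.single u (Suc 0) + k = Poly_Mapping.single v (Suc 0) + l"
      "Poly_Mapping.lookup f l \<noteq> 0"
    by (rule keys_single_times)
  have "Poly_Mapping.lookup l u = Suc N"
    using arg_cong[OF l(1), of "\<lambda>m. Poly_Mapping.lookup m u"] assms(1) k(2)
    by (simp add: lookup_add lookup_single when_def)
  then show False using le[of l] l(2) by (simp add: in_keys_iff)
qed

lemma ren_Var [simp]: "ren h (Var u) = Var (h u)"
  by (simp add: ren_single)

text \<open>
  Substituting \<open>v\<close> for \<open>u\<close> is reduction modulo \<open>u - v\<close>. The congruence is multiplicative, so it
  suffices to see it on powers of a single variable.
\<close>

lemma Var_diff_dvd_ren:
  fixes f :: "('v, 'r::comm_ring_1) mpoly"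
  shows "Var u - Var v dvd f - ren (id(u := v)) f"
proof (induction f rule: poly_mapping_induct)
  case zero show ?case by simp
next
  case (add f g)
  then show ?case
    using dvd_add[OF add] by (simp add: ren_add algebra_simps)
next
  case (single k c)
  have *: "Var u - Var v dvd Poly_Mapping.single k (1::'r) - ren (id(u := v)) (Poly_Mapping.single k 1)" for k
  proof (induction k rule: poly_mapping_induct)
    case zero show ?case by (simp add: ren_single)
  next
    case (add k l)
    let ?k = "Poly_Mapping.single k (1::'r)" and ?l = "Poly_Mapping.single l (1::'r)"
    let ?r = "ren (id(u := v))"
    have "?k * ?l - ?r (?k * ?l) = (?k - ?r ?k) * ?l + ?r ?k * (?l - ?r ?l)"
      by (simp add: ren_mult algebra_simps)
    also have "Var u - Var v dvd \<dots>" using add by (intro dvd_add dvd_mult2 dvd_mult)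
    finally have "Var u - Var v dvd ?k * ?l - ?r (?k * ?l)" .
    moreover have "?k * ?l = Poly_Mapping.single (k + l) 1" by (simp add: mult_single)
    ultimately show ?case by (simp only:)
  next
    case (single w e)
    show ?case
    proof (cases "w = u")
      case False
      then show ?thesis by (simp add: ren_single)
    next
      case True
      have pow: "Poly_Mapping.single (Poly_Mapping.single a e) (1::'r) = Var a ^ e" for a :: 'v
      proof (induction e)
        case (Suc e)
        have "Poly_Mapping.single (Poly_Mapping.single a (Suc e)) (1::'r)
            = Var a * Poly_Mapping.single (Poly_Mapping.single a e) 1"
          by (simp add: mult_single flip: single_add)
        then show ?case using Suc by simp
      qed simp
      have "Var u - Var v dvd Var u ^ e - (Var v :: ('v, 'r) mpoly) ^ e"
        by (simp add: power_diff_sumr2)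
      moreover have "ren (id(u := v)) (Poly_Mapping.single (Poly_Mapping.single u e) (1::'r))
          = Poly_Mapping.single (Poly_Mapping.single v e) 1"
        by (simp add: ren_single)
      ultimately show ?thesis using True by (simp only: pow)
    qed
  qed
  have "Poly_Mapping.single k c = Poly_Mapping.single 0 c * Poly_Mapping.single k 1"
    by (simp add: mult_single)
  then have "Poly_Mapping.single k c - ren (id(u := v)) (Poly_Mapping.single k c) =
     Poly_Mapping.single 0 c * (Poly_Mapping.single k 1 - ren (id(u := v)) (Poly_Mapping.single k 1))"
    by (simp add: right_diff_distrib ren_single mult_single)
  then show ?case by (simp only: dvd_mult[OF *])
qed

text \<open>
  The substitution \<open>u := v\<close> fixes \<open>y - z\<close>, since neither \<open>y\<close> nor \<open>z\<close> is \<open>u\<close>; so \<open>y - z\<close> is still regular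
  after reduction modulo \<open>u - v\<close>.
\<close>

lemma Var_diff_dvd_cancel:
  fixes f :: "('v, 'r::comm_ring_1) mpoly"
  assumes dvd: "Var u - Var v dvd (Var y - Var z) * f" and "y \<noteq> z" "u \<notin> {y, z}"
  shows "Var u - Var v dvd f"
proof -
  let ?s = "ren (id(u := v)) :: ('v, 'r) mpoly \<Rightarrow> ('v, 'r) mpoly"
  from dvd obtain g where "(Var y - Var z) * f = (Var u - Var v) * g" ..
  then have "?s ((Var y - Var z) * f) = ?s ((Var u - Var v) * g)" by simp
  then have "(Var y - Var z) * ?s f = 0"
    using assms(3) by (simp add: ren_mult ren_diff split: if_splits)
  then have "?s f = 0" using Var_diff_nonzero_divisor[OF assms(2)] by blast
  then show ?thesis using Var_diff_dvd_ren[of u v f] by simp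
qed

section \<open>The tensor power as a polynomial ring\<close>

abbreviation slot :: "nat \<Rightarrow> ('v, 'r::comm_ring_1) mpoly \<Rightarrow> (nat \<times> 'v, 'r) mpoly"
  where "slot j \<equiv> ren (Pair j)"

text \<open>
  Slots are numbered from 1, as in the action of permutations of \<open>{1..n}\<close>; list positions start at 0.
\<close>

definition word_poly :: "nat \<Rightarrow> ('v, 'r::comm_ring_1) mpoly list \<Rightarrow> (nat \<times> 'v, 'r) mpoly"
  where "word_poly n xs = (\<Prod>j\<in>{1..n}. slot j (xs ! (j - 1)))"

lemma word_poly_split:
  assumes "Suc (length xs + length ys) = n"
  shows "word_poly n (xs @ a # ys) = slot (Suc (length xs)) a * word_poly n (xs @ 1 # ys)"
proof -
  let ?k = "Suc (length xs)"
  have k: "?k \<in> {1..n}" using assms by simp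
  have "(\<Prod>j\<in>{1..n} - {?k}. slot j ((xs @ a # ys) ! (j - 1))) =
      (\<Prod>j\<in>{1..n} - {?k}. slot j ((xs @ 1 # ys) ! (j - 1)))"
    by (rule prod.cong) (auto simp: nth_append nth_Cons')
  moreover have "word_poly n (xs @ b # ys) =
      slot ?k b * (\<Prod>j\<in>{1..n} - {?k}. slot j ((xs @ b # ys) ! (j - 1)))" for b
    unfolding word_poly_def by (subst prod.remove[OF _ k]) simp_all
  ultimately show ?thesis by simp
qed

lemma word_poly_mult:
  assumes "length xs = n" "length ys = n"
  shows "word_poly n (map2 (*) xs ys) = word_poly n xs * word_poly n ys"
  unfolding word_poly_def prod.distrib[symmetric]
  by (rule prod.cong) (use assms in \<open>auto simp: ren_mult\<close>)

lemma fsmult_mult_left: "fsmult c (p * q) = fsmult c p * (q :: ('v, 'r::comm_ring_1) mpoly)"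
  by (simp add: fsmult_eq_times mult.assoc)

lemma fsmult_mult_right: "fsmult c (p * q) = p * fsmult c (q :: ('v, 'r::comm_ring_1) mpoly)"
  by (simp add: fsmult_eq_times mult_ac)

lemma word_poly_hom:
  assumes "Suc (length xs + length ys) = n"
  shows "module_hom fsmult fsmult (\<lambda>a. word_poly n (xs @ a # ys))"
proof -
  define r where "r = word_poly n (xs @ 1 # ys)"
  have "word_poly n (xs @ a # ys) = slot (Suc (length xs)) a * r" for a
    unfolding r_def by (rule word_poly_split[OF assms])
  then show ?thesis
    by unfold_locales (simp_all add: ren_add ren_fsmult fsmult_mult_left distrib_right)
qed

text \<open>
  The linear extension of \<open>word_poly\<close> to the free module on words. It kills the multilinearity
  relations, hence descends to tensors. Words of any other length are sent to 0.
\<close>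

definition free_poly :: "nat \<Rightarrow> (('v, 'r::comm_ring_1) mpoly list \<Rightarrow>\<^sub>0 'r) \<Rightarrow> (nat \<times> 'v, 'r) mpoly"
  where "free_poly n = add_ext (\<lambda>xs c. if length xs = n then fsmult c (word_poly n xs) else 0)"

lemma free_poly_single:
  "free_poly n (Poly_Mapping.single xs c) = (if length xs = n then fsmult c (word_poly n xs) else 0)"
  by (simp add: free_poly_def add_ext_single)

lemma free_poly_add: "free_poly n (u + v) = free_poly n u + free_poly n v"
  unfolding free_poly_def
  by (rule add_ext_add) (simp_all add: free_module.scale_left_distrib)

lemma free_poly_diff: "free_poly n (u - v) = free_poly n u - free_poly n v"
  using free_poly_add[of n "u - v" v] by simp

lemma free_poly_zero [simp]: "free_poly n 0 = 0"
  by (simp add: free_poly_def)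

lemma free_poly_fsmult: "free_poly n (fsmult c u) = fsmult c (free_poly n u)"
  by (induction u rule: poly_mapping_induct)
     (simp_all add: free_poly_add free_poly_single free_module.scale_right_distrib)

lemma free_poly_relators:
  assumes "u \<in> free_module.span multilinear_relators"
  shows "free_poly n u = 0"
  using assms
proof (induction rule: free_module.span_induct_alt)
  case base
  show ?case by simp
next
  case (step c r v)
  have "free_poly n r = 0"
    using step.hyps unfolding multilinear_relators_def
    by (auto simp: free_poly_diff free_poly_single free_poly_fsmult
        module_hom.add[OF word_poly_hom] module_hom.scale[OF word_poly_hom])
  then show ?case
    using step by (simp add: free_poly_add free_poly_fsmult)
qed

definition poly_of :: "nat \<Rightarrow> ('v, 'r::comm_ring_1) tensor \<Rightarrow> (nat \<times> 'v, 'r) mpoly"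
  where "poly_of n t = free_poly n (rep_tensor t)"

lemma poly_of_abs: "poly_of n (abs_tensor u) = free_poly n u"
proof -
  have "tensor_eq (rep_tensor (abs_tensor u)) u"
    by (metis Quotient3_tensor Quotient3_rep_abs equivp_reflp equivp_tensor_eq)
  then have "free_poly n (rep_tensor (abs_tensor u) - u) = 0"
    unfolding tensor_eq_def by (rule free_poly_relators)
  then show ?thesis by (simp add: poly_of_def free_poly_diff)
qed

lemma module_hom_poly_of:
  "module_hom tsmult fsmult (poly_of n :: ('v, 'r::comm_ring_1) tensor \<Rightarrow> _)"
proof (unfold_locales)
  fix s t :: "('v, 'r) tensor" and c
  show "poly_of n (s + t) = poly_of n s + poly_of n t"
    by (cases s rule: tensor_abs_cases, cases t rule: tensor_abs_cases)
       (simp add: plus_tensor.abs_eq poly_of_abs free_poly_add)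
  show "poly_of n (tsmult c t) = fsmult c (poly_of n t)"
    by (cases t rule: tensor_abs_cases) (simp add: tsmult.abs_eq poly_of_abs free_poly_fsmult)
qed

lemmas poly_of_add = module_hom.add[OF module_hom_poly_of]
  and poly_of_diff = module_hom.diff[OF module_hom_poly_of]
  and poly_of_scale = module_hom.scale[OF module_hom_poly_of]
  and poly_of_zero [simp] = module_hom.zero[OF module_hom_poly_of]

lemma poly_of_pure: "length xs = n \<Longrightarrow> poly_of n (pure_tensor xs) = word_poly n xs"
  by (simp add: pure_tensor_def poly_of_abs free_poly_single)

lemma pure_tensor_in_space: "length xs = n \<Longrightarrow> pure_tensor xs \<in> tensor_space n"
  unfolding tensor_space_def by (rule tensor.span_base) auto

lemma tensor_space_add: "s \<in> tensor_space n \<Longrightarrow> t \<in> tensor_space n \<Longrightarrow> s + t \<in> tensor_space n"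
  and tensor_space_diff: "s \<in> tensor_space n \<Longrightarrow> t \<in> tensor_space n \<Longrightarrow> s - t \<in> tensor_space n"
  and tensor_space_neg: "s \<in> tensor_space n \<Longrightarrow> - s \<in> tensor_space n"
  and tensor_space_scale: "s \<in> tensor_space n \<Longrightarrow> tsmult c s \<in> tensor_space n"
  and tensor_space_zero: "0 \<in> tensor_space n"
  unfolding tensor_space_def
  by (simp_all add: tensor.span_add tensor.span_diff tensor.span_neg tensor.span_scale tensor.span_zero)

lemma tensor_space_induct [consumes 1, case_names zero pure add scale]:
  assumes "t \<in> tensor_space n"
    and "P 0" "\<And>xs. length xs = n \<Longrightarrow> P (pure_tensor xs)"
    and "\<And>s t. s \<in> tensor_space n \<Longrightarrow> t \<in> tensor_space n \<Longrightarrow> P s \<Longrightarrow> P t \<Longrightarrow> P (s + t)"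
    and "\<And>c t. t \<in> tensor_space n \<Longrightarrow> P t \<Longrightarrow> P (tsmult c t)"
  shows "P t"
proof -
  have "t \<in> tensor_space n \<and> P t"
    using assms(1) unfolding tensor_space_def
  proof (induction rule: tensor.span_induct_alt)
    case base
    then show ?case using assms(2) tensor_space_zero unfolding tensor_space_def by auto
  next
    case (step c x y)
    then show ?case using assms tensor_space_scale tensor_space_add pure_tensor_in_space
      unfolding tensor_space_def by fastforce
  qed
  then show ?thesis by simp
qed

text \<open>
  The candidate inverse of \<open>poly_of\<close> sends a monomial to the pure tensor of its parts: the part in
  slot \<open>j\<close> collects the variables tagged with \<open>j\<close>. Variables tagged outside \<open>{1..n}\<close> are set to 1, so
  that the map is multiplicative on all polynomials.
\<close>

definition monomial_word :: "nat \<Rightarrow> ((nat \<times> 'v) \<Rightarrow>\<^sub>0 nat) \<Rightarrow> ('v, 'r::comm_ring_1) mpoly list"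
  where "monomial_word n k = map (\<lambda>j. Poly_Mapping.single (Poly_Mapping.map_key (Pair j) k) 1) [1..<Suc n]"

definition tensor_of :: "nat \<Rightarrow> (nat \<times> 'v, 'r::comm_ring_1) mpoly \<Rightarrow> ('v, 'r) tensor"
  where "tensor_of n = add_ext (\<lambda>k c. tsmult c (pure_tensor (monomial_word n k)))"

lemma length_monomial_word [simp]: "length (monomial_word n k) = n"
  by (simp add: monomial_word_def)

lemma inj_Pair [simp]: "inj (Pair j)"
  by (simp add: inj_on_def)

lemma monomial_word_add:
  "monomial_word n (k + l) = (map2 (*) (monomial_word n k) (monomial_word n l) :: ('v, 'r::comm_ring_1) mpoly list)"
  by (rule nth_equalityI) (simp_all add: monomial_word_def map_key_plus mult_single del: upt_Suc)

lemma tensor_of_single: "tensor_of n (Poly_Mapping.single k c) = tsmult c (pure_tensor (monomial_word n k))"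
  by (simp add: tensor_of_def add_ext_single)

lemma tensor_of_zero [simp]: "tensor_of n 0 = 0"
  by (simp add: tensor_of_def)

lemma tensor_of_add: "tensor_of n (p + q) = tensor_of n p + tensor_of n q"
  unfolding tensor_of_def by (rule add_ext_add) (simp_all add: tensor.scale_left_distrib)

lemma tensor_of_scale: "tensor_of n (fsmult c p) = tsmult c (tensor_of n p)"
  by (induction p rule: poly_mapping_induct)
     (simp_all add: tensor_of_add tensor_of_single tensor.scale_right_distrib free_module.scale_right_distrib)

lemma tensor_of_in_space: "tensor_of n p \<in> tensor_space n"
  by (induction p rule: poly_mapping_induct)
     (simp_all add: tensor_of_add tensor_of_single tensor_space_add tensor_space_scale
       tensor_space_zero pure_tensor_in_space)

lemma word_poly_monomials:
  "word_poly n (map (\<lambda>k. Poly_Mapping.single k 1) ks) =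
     (Poly_Mapping.single (\<Sum>j\<in>{1..n}. push (Pair j) (ks ! (j - 1))) (1::'r::comm_ring_1))"
  if "length ks = n"
proof -
  have prod_single: "(\<Prod>j\<in>J. Poly_Mapping.single (k j) (1::'r)) = Poly_Mapping.single (\<Sum>j\<in>J. k j) 1"
    if "finite J" for J :: "nat set" and k :: "nat \<Rightarrow> (nat \<times> 'a) \<Rightarrow>\<^sub>0 nat"
    using that by (induction J) (simp_all add: mult_single)
  have "word_poly n (map (\<lambda>k. Poly_Mapping.single k (1::'r)) ks) =
      (\<Prod>j\<in>{1..n}. Poly_Mapping.single (push (Pair j) (ks ! (j - 1))) (1::'r))"
    unfolding word_poly_def by (rule prod.cong) (use that in \<open>auto simp: ren_single\<close>)
  then show ?thesis by (simp add: prod_single)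
qed

lemma map_key_push_Pair:
  "Poly_Mapping.map_key (Pair i) (push (Pair j) k) = (if i = j then k else 0)"
  by (induction k rule: poly_mapping_induct)
     (auto simp: push_add map_key_plus map_key.rep_eq lookup_single when_def intro!: poly_mapping_eqI)

lemma map_key_sum:
  "inj h \<Longrightarrow> Poly_Mapping.map_key h (sum f S) = (\<Sum>x\<in>S. Poly_Mapping.map_key h (f x))"
  by (induction S rule: infinite_finite_induct) (simp_all add: map_key_plus)

lemma monomial_word_sum:
  assumes "length ks = n"
  shows "monomial_word n (\<Sum>j\<in>{1..n}. push (Pair j) (ks ! (j - 1))) = map (\<lambda>k. Poly_Mapping.single k 1) ks"
proof (rule nth_equalityI)
  fix i assume "i < length (monomial_word n (\<Sum>j\<in>{1..n}. push (Pair j) (ks ! (j - 1))) :: ('a, 'b) mpoly list)"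
  then show "(monomial_word n (\<Sum>j\<in>{1..n}. push (Pair j) (ks ! (j - 1))) :: ('a, 'b) mpoly list) ! i =
      map (\<lambda>k. Poly_Mapping.single k 1) ks ! i"
    using assms
    by (simp add: monomial_word_def map_key_sum map_key_push_Pair sum.delta del: upt_Suc)
qed (use assms in simp)

text \<open>
  By multilinearity a pure tensor is a combination of pure tensors of monomials. The induction
  expands the entries one at a time from the back: all entries behind the current one are
  already monomials.
\<close>

lemma pure_tensor_induct:
  assumes "length xs = n"
    and mono: "\<And>ks. length ks = n \<Longrightarrow> P (pure_tensor (map (\<lambda>k. Poly_Mapping.single k 1) ks))"
    and add: "\<And>s t. P s \<Longrightarrow> P t \<Longrightarrow> P (s + t)"
    and scale: "\<And>c t. P t \<Longrightarrow> P (tsmult c t)"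
  shows "P (pure_tensor (xs :: ('v, 'r::comm_ring_1) mpoly list))"
proof -
  have "P (pure_tensor (xs @ map (\<lambda>k. Poly_Mapping.single k 1) ks))" if "length xs + length ks = n"
    for xs :: "('v, 'r) mpoly list" and ks
    using that
  proof (induction xs arbitrary: ks rule: rev_induct)
    case Nil
    then show ?case using mono by simp
  next
    case (snoc a xs)
    let ?ys = "map (\<lambda>k. Poly_Mapping.single k (1::'r)) ks"
    have base: "P (pure_tensor (xs @ Poly_Mapping.single k 1 # ?ys))" for k
      using snoc.IH[of "k # ks"] snoc.prems by simp
    have single: "P (pure_tensor (xs @ Poly_Mapping.single k c # ?ys))" for k c
      using scale[OF base[of k], of c] by (simp flip: pure_tensor_scale)
    have "P (pure_tensor (xs @ a # ?ys))"
    proof (induction a rule: poly_mapping_induct)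
      case zero
      show ?case using single[of 0 0] by simp
    next
      case (add a b)
      then show ?case using assms(3) by (simp add: pure_tensor_add)
    qed (rule single)
    then show ?case by simp
  qed
  from this[of xs "[]"] show ?thesis using assms(1) by simp
qed

text \<open>
  This makes \<open>poly_of\<close> injective on the tensor power, so that identities between tensors can be
  verified for polynomials, where ring arithmetic is available.
\<close>

lemma tensor_of_poly_of: "tensor_of n (poly_of n t) = t" if "t \<in> tensor_space n"
  using that
proof (induction rule: tensor_space_induct)
  case (pure xs)
  let ?P = "\<lambda>t. tensor_of n (poly_of n t) = t"
  show ?case
  proof (rule pure_tensor_induct[where P = ?P, OF pure])
    fix ks :: "('a \<Rightarrow>\<^sub>0 nat) list" assume "length ks = n"
    then show "?P (pure_tensor (map (\<lambda>k. Poly_Mapping.single k 1) ks))"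
      by (simp add: poly_of_pure word_poly_monomials tensor_of_single monomial_word_sum del: One_nat_def)
  qed (simp_all add: poly_of_add poly_of_scale tensor_of_add tensor_of_scale)
qed (simp_all add: poly_of_add poly_of_scale tensor_of_add tensor_of_scale)

lemma poly_of_inj: "s \<in> tensor_space n \<Longrightarrow> t \<in> tensor_space n \<Longrightarrow> poly_of n s = poly_of n t \<Longrightarrow> s = t"
  by (metis tensor_of_poly_of)

text \<open>
  Both sides of each multilinearity identity lie in the tensor power, where \<open>poly_of\<close> is injective,
  so linearity of the polynomials in each single argument suffices.
\<close>

lemma multilinearI:
  assumes "\<And>xs. length xs = n \<Longrightarrow> f xs \<in> tensor_space n"
    and "\<And>ps qs. Suc (length ps + length qs) = n \<Longrightarrow>
      \<exists>H. module_hom fsmult fsmult H \<and> (\<forall>a. poly_of n (f (ps @ a # qs)) = H a)"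
  shows "multilinear n f"
  unfolding multilinear_def
proof (intro conjI allI impI)
  fix ps qs :: "('a, 'b) mpoly list" and a b
  assume l: "Suc (length ps + length qs) = n"
  from assms(2)[OF l] obtain H where H: "module_hom fsmult fsmult H"
    "\<And>a. poly_of n (f (ps @ a # qs)) = H a" by blast
  show "f (ps @ (a + b) # qs) = f (ps @ a # qs) + f (ps @ b # qs)"
    by (rule poly_of_inj[of _ n])
       (use l in \<open>simp_all add: assms(1) tensor_space_add poly_of_add H(2) module_hom.add[OF H(1)]\<close>)
next
  fix ps qs :: "('a, 'b) mpoly list" and a c
  assume l: "Suc (length ps + length qs) = n"
  from assms(2)[OF l] obtain H where H: "module_hom fsmult fsmult H"
    "\<And>a. poly_of n (f (ps @ a # qs)) = H a" by blast
  show "f (ps @ fsmult c a # qs) = tsmult c (f (ps @ a # qs))"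
    by (rule poly_of_inj[of _ n])
       (use l in \<open>simp_all add: assms(1) tensor_space_scale poly_of_scale H(2) module_hom.scale[OF H(1)]\<close>)
qed

lemma tensor_lift_zero: "multilinear n f \<Longrightarrow> tensor_lift n f 0 = 0"
  using tensor_lift_add[of n f 0 0] by simp

lemma tensor_lift_in_space:
  assumes "multilinear n f" "\<And>xs. length xs = n \<Longrightarrow> f xs \<in> tensor_space n" "t \<in> tensor_space n"
  shows "tensor_lift n f t \<in> tensor_space n"
  using assms(3)
  by (induction rule: tensor_space_induct)
     (simp_all add: assms tensor_lift_zero tensor_lift_pure tensor_lift_add tensor_lift_scale
       tensor_space_add tensor_space_scale tensor_space_zero)

text \<open>
  The polynomial of a pure tensor is multilinear in its entries, hence so is its image under a linear
  map \<open>H\<close>; and linear maps that agree on pure tensors agree on the tensor power. The cases of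
  interest are multiplication by a fixed polynomial and renaming of the slots.
\<close>

lemma
  assumes closed: "\<And>xs. length xs = n \<Longrightarrow> f xs \<in> tensor_space n"
    and H: "module_hom fsmult fsmult H"
    and f: "\<And>xs. length xs = n \<Longrightarrow> poly_of n (f xs) = H (word_poly n xs)"
  shows multilinear_word_polyI: "multilinear n f"
    and poly_of_tensor_lift: "t \<in> tensor_space n \<Longrightarrow> poly_of n (tensor_lift n f t) = H (poly_of n t)"
proof -
  show m: "multilinear n f"
  proof (rule multilinearI[OF closed])
    fix ps qs :: "('a, 'b) mpoly list"
    assume l: "Suc (length ps + length qs) = n"
    have "module_hom fsmult fsmult (H \<circ> (\<lambda>a. word_poly n (ps @ a # qs)))"
      by (rule module_hom_compose[OF word_poly_hom[OF l] H])
    then show "\<exists>H. module_hom fsmult fsmult H \<and> (\<forall>a. poly_of n (f (ps @ a # qs)) = H a)"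
      using l by (intro exI[of _ "H \<circ> (\<lambda>a. word_poly n (ps @ a # qs))"]) (simp add: f)
  qed
  show "t \<in> tensor_space n \<Longrightarrow> poly_of n (tensor_lift n f t) = H (poly_of n t)"
    by (induction rule: tensor_space_induct)
       (simp_all add: tensor_lift_zero[OF m] tensor_lift_pure[OF m] tensor_lift_add[OF m]
         tensor_lift_scale[OF m] poly_of_add poly_of_scale f poly_of_pure
         module_hom.zero[OF H] module_hom.add[OF H] module_hom.scale[OF H])
qed

lemma module_hom_times: "module_hom fsmult fsmult ((*) (p :: ('v, 'r::comm_ring_1) mpoly))"
  by unfold_locales (simp_all add: distrib_left fsmult_mult_right)

lemma module_hom_times': "module_hom fsmult fsmult (\<lambda>q. q * (p :: ('v, 'r::comm_ring_1) mpoly))"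
  by unfold_locales (simp_all add: distrib_right fsmult_mult_left)

lemma module_hom_ren: "module_hom fsmult fsmult (ren h)"
  by unfold_locales (simp_all add: ren_add ren_fsmult)

text \<open>
  The product is defined by extending linearly in one factor after the other. Under \<open>poly_of\<close> both
  extensions become multiplication maps.
\<close>

lemma
  fixes t :: "('v, 'r::comm_ring_1) tensor"
  assumes s: "s \<in> tensor_space n" and t: "t \<in> tensor_space n"
  shows tensor_mult_in_space: "tensor_mult n s t \<in> tensor_space n"
    and poly_of_mult: "poly_of n (tensor_mult n s t) = poly_of n s * poly_of n t"
proof -
  define f :: "('v, 'r) mpoly list \<Rightarrow> ('v, 'r) tensor" where "f xs = tensor_lift n (\<lambda>ys. pure_tensor (map2 (*) xs ys)) t" for xs
  have 1: "f xs \<in> tensor_space n" "poly_of n (f xs) = word_poly n xs * poly_of n t"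
    if "length xs = n" for xs
  proof -
    show "f xs \<in> tensor_space n"
      unfolding f_def
      by (rule tensor_lift_in_space[OF multilinear_map2[OF that] _ t]) (simp add: pure_tensor_in_space that)
    show "poly_of n (f xs) = word_poly n xs * poly_of n t"
      unfolding f_def
      by (rule poly_of_tensor_lift[OF _ module_hom_times _ t])
         (simp_all add: pure_tensor_in_space poly_of_pure word_poly_mult that)
  qed
  have f: "tensor_mult n s t = tensor_lift n f s"
    unfolding tensor_mult_def f_def[abs_def] ..
  have m: "multilinear n f"
    by (rule multilinear_word_polyI[OF _ module_hom_times'[of "poly_of n t"]]) (simp_all add: 1)
  show "tensor_mult n s t \<in> tensor_space n"
    unfolding f by (rule tensor_lift_in_space[OF m 1(1) s])
  show "poly_of n (tensor_mult n s t) = poly_of n s * poly_of n t"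
    unfolding f by (rule poly_of_tensor_lift[OF _ module_hom_times' _ s]) (simp_all add: 1)
qed

text \<open>
  Needed to recognise a quotient computed among polynomials as a tensor: \<open>tensor_of\<close> is
  multiplicative even on polynomials that use variables outside the first \<open>n\<close> slots.
\<close>

lemma tensor_of_mult:
  "tensor_of n (p * q) = tensor_mult n (tensor_of n p) (tensor_of n (q :: (nat \<times> 'v, 'r::comm_ring_1) mpoly))"
proof -
  have eqI: "u = tensor_mult n s t" if "u \<in> tensor_space n" "s \<in> tensor_space n" "t \<in> tensor_space n"
    "poly_of n u = poly_of n s * poly_of n t" for s t u :: "('v, 'r) tensor"
    using that by (intro poly_of_inj[of _ n]) (simp_all add: tensor_mult_in_space poly_of_mult)
  have "poly_of n (tensor_of n (p * q)) = poly_of n (tensor_of n p) * poly_of n (tensor_of n q)"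
  proof (induction p rule: poly_mapping_induct)
    case (single k c)
    show ?case
    proof (induction q rule: poly_mapping_induct)
      case (single l d)
      show ?case
        by (simp add: mult_single tensor_of_single poly_of_scale poly_of_pure monomial_word_add
            word_poly_mult mult.commute flip: fsmult_mult_left fsmult_mult_right)
    qed (simp_all add: distrib_left tensor_of_add poly_of_add)
  qed (simp_all add: distrib_right tensor_of_add poly_of_add)
  then show ?thesis by (intro eqI) (simp_all add: tensor_of_in_space)
qed

section \<open>The permutation action\<close>

definition perm_vars :: "(nat \<Rightarrow> nat) \<Rightarrow> (nat \<times> 'v, 'r::comm_ring_1) mpoly \<Rightarrow> (nat \<times> 'v, 'r) mpoly"
  where "perm_vars \<sigma> = ren (map_prod \<sigma> id)"

lemma perm_vars_mult: "perm_vars \<sigma> (p * q) = perm_vars \<sigma> p * perm_vars \<sigma> q"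
  and perm_vars_diff: "perm_vars \<sigma> (p - q) = perm_vars \<sigma> p - perm_vars \<sigma> q"
  and perm_vars_prod: "perm_vars \<sigma> (prod g S) = (\<Prod>j\<in>S. perm_vars \<sigma> (g j))"
  and module_hom_perm_vars: "module_hom fsmult fsmult (perm_vars \<sigma>)"
  by (simp_all add: perm_vars_def ren_mult ren_diff ren_prod module_hom_ren)

lemma perm_vars_comp: "perm_vars (\<sigma> \<circ> \<tau>) p = perm_vars \<sigma> (perm_vars \<tau> p)"
  by (simp add: perm_vars_def ren_ren map_prod.comp)

lemma perm_vars_id: "perm_vars id p = p"
  by (simp add: perm_vars_def prod.map_id0 ren_id)

lemma perm_vars_slot [simp]: "perm_vars \<sigma> (slot j (a :: ('v, 'r::comm_ring_1) mpoly)) = slot (\<sigma> j) a"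
proof -
  have "map_prod \<sigma> id \<circ> Pair j = (Pair (\<sigma> j) :: 'v \<Rightarrow> _)" by auto
  then show ?thesis by (simp add: perm_vars_def ren_ren)
qed

text \<open>
  The entry in slot \<open>j\<close> moves to slot \<open>\<sigma> j\<close>, so the action on tensors is a renaming of variables.
\<close>

lemma word_poly_permute:
  assumes s: "\<sigma> permutes {1..n}" and "length xs = n"
  shows "word_poly n (map (\<lambda>i. xs ! (inv' \<sigma> i - 1)) [1..<Suc n]) = perm_vars \<sigma> (word_poly n xs)"
proof -
  have "perm_vars \<sigma> (word_poly n xs) = (\<Prod>j\<in>{1..n}. slot (\<sigma> j) (xs ! (j - 1)))"
    by (simp add: word_poly_def perm_vars_prod)
  also have "\<dots> = (\<Prod>j\<in>{1..n}. slot j (xs ! (inv' \<sigma> j - 1)))"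
    by (subst prod.permute[OF s]) (simp add: comp_def permutes_inverses[OF s])
  also have "\<dots> = word_poly n (map (\<lambda>i. xs ! (inv' \<sigma> i - 1)) [1..<Suc n])"
    unfolding word_poly_def by (rule prod.cong) (auto simp del: upt_Suc)
  finally show ?thesis ..
qed

context
  fixes n :: nat and \<sigma> :: "nat \<Rightarrow> nat"
  assumes s: "\<sigma> permutes {1..n}"
begin

lemma multilinear_permute:
  "multilinear n (\<lambda>xs. pure_tensor (map (\<lambda>i. xs ! (inv' \<sigma> i - 1)) [1..<Suc n]) :: ('v, 'r::comm_ring_1) tensor)"
  by (rule multilinear_word_polyI[OF _ module_hom_perm_vars[of \<sigma>]])
     (simp_all add: pure_tensor_in_space poly_of_pure word_poly_permute[OF s] del: upt_Suc One_nat_def)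

lemma sym_action_in_space: "t \<in> tensor_space n \<Longrightarrow> sym_action n \<sigma> t \<in> tensor_space n"
  unfolding sym_action_def
  by (rule tensor_lift_in_space[OF multilinear_permute]) (simp_all add: pure_tensor_in_space del: upt_Suc)

lemma poly_of_sym_action: "t \<in> tensor_space n \<Longrightarrow> poly_of n (sym_action n \<sigma> t) = perm_vars \<sigma> (poly_of n t)"
  unfolding sym_action_def
  by (rule poly_of_tensor_lift[OF _ module_hom_perm_vars])
     (simp_all add: pure_tensor_in_space poly_of_pure word_poly_permute[OF s] del: upt_Suc One_nat_def)

lemma sym_action_add: "sym_action n \<sigma> (s + t) = sym_action n \<sigma> s + sym_action n \<sigma> t"
  and sym_action_scale: "sym_action n \<sigma> (tsmult c t) = tsmult c (sym_action n \<sigma> t)"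
  unfolding sym_action_def
  by (simp_all add: tensor_lift_add[OF multilinear_permute] tensor_lift_scale[OF multilinear_permute] del: upt_Suc One_nat_def)

lemma sym_action_zero: "sym_action n \<sigma> 0 = 0"
  unfolding sym_action_def by (rule tensor_lift_zero[OF multilinear_permute])

lemma sym_action_mult:
  "s \<in> tensor_space n \<Longrightarrow> t \<in> tensor_space n \<Longrightarrow>
    sym_action n \<sigma> (tensor_mult n s t) = tensor_mult n (sym_action n \<sigma> s) (sym_action n \<sigma> t)"
  by (rule poly_of_inj[of _ n])
     (simp_all add: sym_action_in_space tensor_mult_in_space poly_of_mult poly_of_sym_action perm_vars_mult)

end

lemma sym_action_comp:
  assumes "\<sigma> permutes {1..n}" "\<tau> permutes {1..n}" "t \<in> tensor_space n"
  shows "sym_action n (\<sigma> \<circ> \<tau>) t = sym_action n \<sigma> (sym_action n \<tau> t)"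
  by (rule poly_of_inj[of _ n])
     (use assms in \<open>simp_all add: sym_action_in_space permutes_compose poly_of_sym_action
       perm_vars_comp\<close>)

lemma sym_action_id:
  assumes "t \<in> tensor_space n"
  shows "sym_action n id t = t"
  by (rule poly_of_inj[of _ n])
     (use assms in \<open>simp_all add: sym_action_in_space permutes_id poly_of_sym_action perm_vars_id\<close>)

section \<open>The cyclic group\<close>

definition rot :: "nat \<Rightarrow> nat \<Rightarrow> nat"
  where "rot n = cycle_of_list [1..<Suc n]"

lemma rot_apply:
  assumes "j \<in> {1..n}"
  shows "rot n j = (if j = n then 1 else Suc j)"
proof -
  have "map (rot n) [1..<Suc n] = rotate1 [1..<Suc n]"
    unfolding rot_def using cyclic_rotation[of "[1..<Suc n]" 1] by simp
  then have "map (rot n) [1..<Suc n] ! (j - 1) = rotate1 [1..<Suc n] ! (j - 1)"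
    by (simp only:)
  then show ?thesis
    using assms by (auto simp: nth_rotate1 simp del: upt_Suc)
qed

lemma rot_permutes: "rot n permutes {1..n}"
  using cycle_permutes[of "[1..<Suc n]"] by (simp add: rot_def atLeastLessThanSuc_atLeastAtMost del: upt_Suc)

lemma rot_neq: "n \<ge> 2 \<Longrightarrow> j \<in> {1..n} \<Longrightarrow> rot n j \<noteq> j"
  by (simp add: rot_apply)

lemma cyclic_perm_group_simps [simp]:
  "\<sigma> \<otimes>\<^bsub>cyclic_perm_group n\<^esub> \<tau> = \<sigma> \<circ> \<tau>" "\<one>\<^bsub>cyclic_perm_group n\<^esub> = id"
  by (simp_all add: cyclic_perm_group_def sym_group_def)

lemma cyclic_carrier: "carrier (cyclic_perm_group n) = generate (sym_group n) {rot n}"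
  by (simp add: cyclic_perm_group_def rot_def)

lemma cyclic_subgroup: "subgroup (carrier (cyclic_perm_group n)) (sym_group n)"
  using group.generate_is_subgroup[OF sym_group_is_group, of "{rot n}" n] rot_permutes[of n]
  by (simp add: cyclic_carrier sym_group_carrier)

lemma cyclic_group: "group (cyclic_perm_group n)"
  using subgroup.subgroup_is_group[OF cyclic_subgroup sym_group_is_group, of n]
  by (simp add: cyclic_perm_group_def)

lemma cyclic_permutes: "\<sigma> \<in> carrier (cyclic_perm_group n) \<Longrightarrow> \<sigma> permutes {1..n}"
  using subgroup.subset[OF cyclic_subgroup[of n]] by (auto simp: sym_group_carrier)

lemma cyclic_rot: "rot n \<in> carrier (cyclic_perm_group n)"
  by (simp add: cyclic_carrier generate.incl)

lemma cyclic_comp: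
  "\<sigma> \<in> carrier (cyclic_perm_group n) \<Longrightarrow> \<tau> \<in> carrier (cyclic_perm_group n) \<Longrightarrow>
    \<sigma> \<circ> \<tau> \<in> carrier (cyclic_perm_group n)"
  using subgroup.m_closed[OF cyclic_subgroup] by (simp add: sym_group_mult)

lemma cyclic_inv: "\<sigma> \<in> carrier (cyclic_perm_group n) \<Longrightarrow> inv' \<sigma> \<in> carrier (cyclic_perm_group n)"
  using subgroup.m_inv_closed[OF cyclic_subgroup, of \<sigma> n] cyclic_permutes[of \<sigma> n]
  by (simp add: sym_group_carrier)

text \<open>
  Commuting with the generator is what makes the difference of the slots \<open>c j\<close> and \<open>j\<close> equivariant; it also
  determines an element of the cyclic group by its value at \<open>n\<close>.
\<close>

lemma cyclic_commute:
  assumes "\<sigma> \<in> carrier (cyclic_perm_group n)"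
  shows "\<sigma> (rot n j) = rot n (\<sigma> j)"
proof -
  have "\<sigma> \<in> generate (sym_group n) {rot n}"
    using assms by (simp add: cyclic_carrier)
  then have "\<sigma> \<circ> rot n = rot n \<circ> \<sigma>"
  proof (induction rule: generate.induct)
    case (inv h)
    then show ?case
      using rot_permutes[of n] by (simp add: sym_group_carrier permutes_inv_o)
  next
    case (eng g h)
    then show ?case by (simp add: sym_group_mult) (metis comp_assoc)
  qed (simp_all add: sym_group_one)
  then show ?thesis by (metis comp_apply)
qed

lemma finite_cyclic [simp]: "finite (carrier (cyclic_perm_group n))"
  by (rule finite_subset[OF _ finite_permutations[of "{1..n}"]]) (auto dest: cyclic_permutes)

lemma cyclic_reaches:
  assumes "j \<in> {1..n}"
  obtains \<sigma> where "\<sigma> \<in> carrier (cyclic_perm_group n)" "\<sigma> n = j"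
proof -
  have "j \<ge> 1" "j \<le> n \<Longrightarrow> \<exists>\<sigma>\<in>carrier (cyclic_perm_group n). \<sigma> n = j"
  proof -
    show "j \<ge> 1" using assms by simp
    then show "j \<le> n \<Longrightarrow> \<exists>\<sigma>\<in>carrier (cyclic_perm_group n). \<sigma> n = j"
    proof (induction j rule: dec_induct)
      case base
      then show ?case using cyclic_rot[of n] by (intro bexI) (auto simp: rot_apply)
    next
      case (step j)
      then obtain \<sigma> where \<sigma>: "\<sigma> \<in> carrier (cyclic_perm_group n)" "\<sigma> n = j" by auto
      have "(rot n \<circ> \<sigma>) n = Suc j" using step \<sigma> by (simp add: rot_apply)
      then show ?case using cyclic_comp[OF cyclic_rot \<sigma>(1)] by blast
    qed
  qed
  then show ?thesis using assms that by auto
qed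

lemma cyclic_eqI:
  assumes "\<sigma> \<in> carrier (cyclic_perm_group n)" "\<tau> \<in> carrier (cyclic_perm_group n)" "\<sigma> n = \<tau> n"
  shows "\<sigma> = \<tau>"
proof
  fix j
  show "\<sigma> j = \<tau> j"
  proof (cases "j \<in> {1..n}")
    case False
    then show ?thesis using assms cyclic_permutes permutes_not_in by metis
  next
    case True
    then have "j \<ge> 1" "j \<le> n" by auto
    then show "\<sigma> j = \<tau> j"
    proof (induction j rule: dec_induct)
      case base
      then show ?case
        using cyclic_commute[OF assms(1), of n] cyclic_commute[OF assms(2), of n] assms(3)
        by (simp add: rot_apply)
    next
      case (step j)
      then show ?case
        using cyclic_commute[OF assms(1), of j] cyclic_commute[OF assms(2), of j]
        by (simp add: rot_apply)
    qed
  qed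
qed

text \<open>
  Turns products over the cyclic group into products over slots.
\<close>

lemma cyclic_bij:
  assumes "n \<ge> 1"
  shows "bij_betw (\<lambda>\<sigma>. \<sigma> n) (carrier (cyclic_perm_group n)) {1..n}"
  unfolding bij_betw_def
proof
  show "inj_on (\<lambda>\<sigma>. \<sigma> n) (carrier (cyclic_perm_group n))"
    by (rule inj_onI) (rule cyclic_eqI)
  show "(\<lambda>\<sigma>. \<sigma> n) ` carrier (cyclic_perm_group n) = {1..n}"
    using assms permutes_in_image[OF cyclic_permutes, of _ n n]
    by (auto, metis (no_types, lifting) One_nat_def atLeastAtMost_iff cyclic_reaches image_eqI)
qed

section \<open>The equivariant multi-derivation\<close>

lemma tensor_power_simps [simp]:
  "carrier (tensor_power n) = tensor_space n" "s \<otimes>\<^bsub>tensor_power n\<^esub> t = tensor_mult n s t"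
  "\<one>\<^bsub>tensor_power n\<^esub> = pure_tensor (replicate n 1)" "\<zero>\<^bsub>tensor_power n\<^esub> = 0"
  "s \<oplus>\<^bsub>tensor_power n\<^esub> t = s + t" "c \<odot>\<^bsub>tensor_power n\<^esub> t = tsmult c t"
  by (simp_all add: tensor_power_def)

lemma ring_of_type_simps [simp]:
  "carrier ring_of_type_algebra = UNIV" "a \<otimes>\<^bsub>ring_of_type_algebra\<^esub> b = a * b"
  "\<one>\<^bsub>ring_of_type_algebra\<^esub> = 1" "\<zero>\<^bsub>ring_of_type_algebra\<^esub> = 0"
  "a \<oplus>\<^bsub>ring_of_type_algebra\<^esub> b = a + b"
  by (simp_all add: ring_of_type_algebra_def)

lemma word_poly_one: "word_poly n (replicate n 1) = 1"
  unfolding word_poly_def by (rule prod.neutral) auto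

lemma poly_of_one: "poly_of n (pure_tensor (replicate n 1)) = 1"
  by (simp add: poly_of_pure word_poly_one)

lemma comm_monoid_tensor_power: "comm_monoid (tensor_power n :: ('r, ('v, 'r::comm_ring_1) tensor) module)"
  by (rule comm_monoidI)
     (auto intro!: poly_of_inj[of _ n] simp: tensor_mult_in_space pure_tensor_in_space poly_of_mult
       poly_of_one mult_ac)

lemma
  fixes f :: "'i \<Rightarrow> ('v, 'r::comm_ring_1) tensor"
  assumes "finite S" "\<And>i. i \<in> S \<Longrightarrow> f i \<in> tensor_space n"
  shows finprod_in_space: "finprod (tensor_power n) f S \<in> tensor_space n"
    and poly_of_finprod: "poly_of n (finprod (tensor_power n) f S) = (\<Prod>i\<in>S. poly_of n (f i))"
proof -
  interpret comm_monoid "tensor_power n :: ('r, ('v, 'r) tensor) module" by (rule comm_monoid_tensor_power)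
  show cl: "finprod (tensor_power n) f S \<in> tensor_space n"
    using finprod_closed[of f S] assms by auto
  show "poly_of n (finprod (tensor_power n) f S) = (\<Prod>i\<in>S. poly_of n (f i))"
    using assms
  proof (induction S rule: finite_induct)
    case empty
    then show ?case by (simp add: poly_of_one)
  next
    case (insert x S)
    then have "finprod (tensor_power n) f S \<in> tensor_space n"
      using finprod_closed[of f S] by auto
    then show ?case using insert by (simp add: Pi_iff poly_of_mult)
  qed
qed

lemma tensor_mult_add_left: "s \<in> tensor_space n \<Longrightarrow> s' \<in> tensor_space n \<Longrightarrow> t \<in> tensor_space n \<Longrightarrow>
    tensor_mult n (s + s') t = tensor_mult n s t + tensor_mult n s' t"
  and tensor_mult_add_right: "s \<in> tensor_space n \<Longrightarrow> s' \<in> tensor_space n \<Longrightarrow> t \<in> tensor_space n \<Longrightarrow>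
    tensor_mult n t (s + s') = tensor_mult n t s + tensor_mult n t s'"
  and tensor_mult_scale_left: "s \<in> tensor_space n \<Longrightarrow> t \<in> tensor_space n \<Longrightarrow>
    tensor_mult n (tsmult c s) t = tsmult c (tensor_mult n s t)"
  and tensor_mult_scale_right: "s \<in> tensor_space n \<Longrightarrow> t \<in> tensor_space n \<Longrightarrow>
    tensor_mult n t (tsmult c s) = tsmult c (tensor_mult n t s)"
  and tensor_mult_zero_right: "t \<in> tensor_space n \<Longrightarrow> tensor_mult n t 0 = 0"
  and tensor_mult_zero_left: "t \<in> tensor_space n \<Longrightarrow> tensor_mult n 0 t = 0"
  by (auto intro!: poly_of_inj[of _ n] simp: tensor_mult_in_space tensor_space_add tensor_space_scale
      tensor_space_zero poly_of_mult poly_of_add poly_of_scale distrib_left distrib_right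
      simp flip: fsmult_mult_left fsmult_mult_right)

lemma
  assumes "n \<ge> 1"
  shows in_first_slot_in_space: "in_first_slot n a \<in> tensor_space n"
    and in_last_slot_in_space: "in_last_slot n a \<in> tensor_space n"
    and poly_of_in_first_slot: "poly_of n (in_first_slot n a) = slot 1 a"
    and poly_of_in_last_slot: "poly_of n (in_last_slot n a) = slot n a"
proof -
  show "in_first_slot n a \<in> tensor_space n" "in_last_slot n a \<in> tensor_space n"
    using assms by (simp_all add: in_first_slot_def in_last_slot_def pure_tensor_in_space)
  have *: "word_poly n (replicate i 1 @ a # replicate k 1) = slot (Suc i) a" if l: "Suc (i + k) = n" for i k
  proof -
    have "replicate i 1 @ 1 # replicate k 1 = (replicate n 1 :: ('a, 'b) mpoly list)"
      using replicate_add[of i "Suc k" "1 :: ('a, 'b) mpoly"] l by simp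
    moreover have "word_poly n (replicate n 1 :: ('a, 'b) mpoly list) = 1"
      by (rule word_poly_one)
    moreover have "word_poly n (replicate i 1 @ a # replicate k 1) =
        slot (Suc (length (replicate i (1 :: ('a, 'b) mpoly)))) a * word_poly n (replicate i 1 @ 1 # replicate k 1)"
      by (rule word_poly_split) (use l in simp)
    ultimately show ?thesis by (simp only: length_replicate mult_1_right)
  qed
  show "poly_of n (in_first_slot n a) = slot 1 a"
    using *[of 0 "n - 1"] assms by (simp add: in_first_slot_def poly_of_pure)
  show "poly_of n (in_last_slot n a) = slot n a"
    using *[of "n - 1" 0] assms by (simp add: in_last_slot_def poly_of_pure)
qed

text \<open>
  The difference \<open>D\<^sub>j(a)\<close>. Like every inner derivation it satisfies
  \<open>D\<^sub>j(ab) = a\<^sup>(\<^sup>c\<^sup>j\<^sup>) D\<^sub>j(b) + D\<^sub>j(a) b\<^sup>(\<^sup>j\<^sup>)\<close>.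
\<close>

definition slot_diff :: "nat \<Rightarrow> nat \<Rightarrow> ('v, 'r::comm_ring_1) mpoly \<Rightarrow> (nat \<times> 'v, 'r) mpoly"
  where "slot_diff n j a = slot (rot n j) a - slot j a"

definition phi_poly :: "nat \<Rightarrow> ('v, 'r::comm_ring_1) mpoly list \<Rightarrow> (nat \<times> 'v, 'r) mpoly"
  where "phi_poly n as = (\<Prod>j\<in>{1..n}. slot_diff n j (as ! (j - 1)))"

lemma slot_diff_add: "slot_diff n j (a + b) = slot_diff n j a + slot_diff n j b"
  and slot_diff_scale: "slot_diff n j (fsmult c a) = fsmult c (slot_diff n j a)"
  by (simp_all add: slot_diff_def ren_add ren_fsmult free_module.scale_right_diff_distrib)

lemma phi_poly_split:
  fixes xs ys :: "('v, 'r::comm_ring_1) mpoly list"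
  assumes "Suc (length xs + length ys) = n"
  obtains r where "\<And>a. phi_poly n (xs @ a # ys) = slot_diff n (Suc (length xs)) a * r"
proof -
  let ?k = "Suc (length xs)"
  have k: "?k \<in> {1..n}" using assms by simp
  have rest: "(\<Prod>j\<in>{1..n} - {?k}. slot_diff n j ((xs @ a # ys) ! (j - 1))) =
      (\<Prod>j\<in>{1..n} - {?k}. slot_diff n j ((xs @ 0 # ys) ! (j - 1)))" for a
    by (rule prod.cong) (auto simp: nth_append nth_Cons')
  have "phi_poly n (xs @ a # ys) =
      slot_diff n ?k a * (\<Prod>j\<in>{1..n} - {?k}. slot_diff n j ((xs @ a # ys) ! (j - 1)))" for a
    unfolding phi_poly_def by (subst prod.remove[OF _ k]) simp_all
  then have "phi_poly n (xs @ a # ys) =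
      slot_diff n ?k a * (\<Prod>j\<in>{1..n} - {?k}. slot_diff n j ((xs @ 0 # ys) ! (j - 1)))" for a
    by (simp only: rest[of a])
  then show ?thesis by (rule that)
qed

context
  fixes n :: nat
  assumes n: "n \<ge> 1"
begin

text \<open>
  The element \<open>\<sigma>\<close> carries slot \<open>n\<close> to \<open>\<sigma> n\<close> and slot \<open>1 = c n\<close> to \<open>c (\<sigma> n)\<close>.
\<close>

lemma phi_factor:
  assumes "\<sigma> \<in> carrier (cyclic_perm_group n)"
  shows "sym_action n \<sigma> (in_first_slot n a - in_last_slot n a) \<in> tensor_space n"
    and "poly_of n (sym_action n \<sigma> (in_first_slot n a - in_last_slot n a)) = slot_diff n (\<sigma> n) a"
proof -
  have "rot n n = 1" using n by (simp add: rot_apply)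
  then have "\<sigma> 1 = rot n (\<sigma> n)" using cyclic_commute[OF assms, of n] by simp
  then show "poly_of n (sym_action n \<sigma> (in_first_slot n a - in_last_slot n a)) = slot_diff n (\<sigma> n) a"
    using n by (simp add: poly_of_sym_action[OF cyclic_permutes[OF assms]] tensor_space_diff
        in_first_slot_in_space in_last_slot_in_space poly_of_diff poly_of_in_first_slot
        poly_of_in_last_slot perm_vars_diff slot_diff_def)
  show "sym_action n \<sigma> (in_first_slot n a - in_last_slot n a) \<in> tensor_space n"
    using n by (simp add: sym_action_in_space[OF cyclic_permutes[OF assms]] tensor_space_diff
        in_first_slot_in_space in_last_slot_in_space)
qed

abbreviation phi_word :: "('v, 'r::comm_ring_1) mpoly list \<Rightarrow> ('v, 'r) tensor"
  where "phi_word as \<equiv> \<Otimes>\<^bsub>tensor_power n\<^esub>\<sigma>\<in>carrier (cyclic_perm_group n).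
      sym_action n \<sigma> (in_first_slot n (as ! (\<sigma> n - 1)) - in_last_slot n (as ! (\<sigma> n - 1)))"

lemma phi_word_in_space: "phi_word as \<in> tensor_space n"
  by (rule finprod_in_space) (simp_all add: phi_factor)

lemma poly_of_phi_word: "poly_of n (phi_word as) = phi_poly n as"
proof -
  have "poly_of n (phi_word as) =
      (\<Prod>\<sigma>\<in>carrier (cyclic_perm_group n). slot_diff n (\<sigma> n) (as ! (\<sigma> n - 1)))"
    by (subst poly_of_finprod) (auto simp: phi_factor intro!: prod.cong)
  also have "\<dots> = phi_poly n as"
    unfolding phi_poly_def by (rule prod.reindex_bij_betw[OF cyclic_bij[OF n]])
  finally show ?thesis .
qed

lemma multilinear_phi_word: "multilinear n phi_word"
proof (rule multilinearI[OF phi_word_in_space])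
  fix ps qs :: "('a, 'b) mpoly list"
  assume "Suc (length ps + length qs) = n"
  then obtain r where "\<And>a. phi_poly n (ps @ a # qs) = slot_diff n (Suc (length ps)) a * r"
    using phi_poly_split by blast
  then show "\<exists>H. module_hom fsmult fsmult H \<and> (\<forall>a. poly_of n (phi_word (ps @ a # qs)) = H a)"
    by (intro exI[of _ "\<lambda>a. slot_diff n (Suc (length ps)) a * r"] conjI allI, unfold_locales)
       (simp_all add: poly_of_phi_word slot_diff_add slot_diff_scale distrib_right fsmult_mult_left del: One_nat_def)
qed

lemma phi_map_add: "phi_map n (s + t) = phi_map n s + phi_map n t"
  and phi_map_scale: "phi_map n (tsmult c t) = tsmult c (phi_map n t)"
  unfolding phi_map_def
  by (rule tensor_lift_add[OF multilinear_phi_word] tensor_lift_scale[OF multilinear_phi_word])+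

lemma phi_map_zero: "phi_map n 0 = 0"
  unfolding phi_map_def by (rule tensor_lift_zero[OF multilinear_phi_word])

lemma phi_map_in_space: "t \<in> tensor_space n \<Longrightarrow> phi_map n t \<in> tensor_space n"
  unfolding phi_map_def by (rule tensor_lift_in_space[OF multilinear_phi_word phi_word_in_space])

lemma poly_of_phi_map: "length as = n \<Longrightarrow> poly_of n (phi_map n (pure_tensor as)) = phi_poly n as"
  by (simp add: phi_map_def tensor_lift_pure[OF multilinear_phi_word] poly_of_phi_word del: One_nat_def)

lemma phi_map_sym_action:
  assumes \<sigma>: "\<sigma> \<in> carrier (cyclic_perm_group n)" and "t \<in> tensor_space n"
  shows "phi_map n (sym_action n \<sigma> t) = sym_action n \<sigma> (phi_map n t)"
  using assms(2)
proof (induction rule: tensor_space_induct)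
  note p = cyclic_permutes[OF \<sigma>]
  case (pure xs)
  show ?case
  proof (rule poly_of_inj[of _ n])
    have "poly_of n (sym_action n \<sigma> (phi_map n (pure_tensor xs))) = perm_vars \<sigma> (phi_poly n xs)"
      using pure by (simp add: poly_of_sym_action[OF p] phi_map_in_space pure_tensor_in_space poly_of_phi_map)
    also have "\<dots> = (\<Prod>j\<in>{1..n}. slot_diff n (\<sigma> j) (xs ! (j - 1)))"
      by (simp add: phi_poly_def perm_vars_prod slot_diff_def perm_vars_diff cyclic_commute[OF \<sigma>])
    also have "\<dots> = (\<Prod>j\<in>{1..n}. slot_diff n j (xs ! (inv' \<sigma> j - 1)))"
      by (subst (2) prod.permute[OF p]) (simp add: comp_def permutes_inverses[OF p])
    also have "\<dots> = phi_poly n (map (\<lambda>i. xs ! (inv' \<sigma> i - 1)) [1..<Suc n])"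
      unfolding phi_poly_def by (rule prod.cong) (auto simp del: upt_Suc)
    also have "\<dots> = poly_of n (phi_map n (sym_action n \<sigma> (pure_tensor xs)))"
      using pure by (simp add: sym_action_pure[OF p] poly_of_phi_map del: upt_Suc One_nat_def)
    finally show "poly_of n (phi_map n (sym_action n \<sigma> (pure_tensor xs))) =
        poly_of n (sym_action n \<sigma> (phi_map n (pure_tensor xs)))" ..
  qed (use pure in \<open>simp_all add: phi_map_in_space sym_action_in_space[OF p] pure_tensor_in_space\<close>)
qed (simp_all add: sym_action_add[OF cyclic_permutes[OF \<sigma>]] sym_action_scale[OF cyclic_permutes[OF \<sigma>]]
    sym_action_zero[OF cyclic_permutes[OF \<sigma>]] phi_map_add phi_map_scale phi_map_zero)

end

section \<open>The modules and their cyclic actions\<close>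

lemma group_moduleI:
  assumes G: "group G" and M: "module R M"
    and closed: "\<And>g x. g \<in> carrier G \<Longrightarrow> x \<in> carrier M \<Longrightarrow> \<rho> g x \<in> carrier M"
    and mult: "\<And>g h x. g \<in> carrier G \<Longrightarrow> h \<in> carrier G \<Longrightarrow> x \<in> carrier M \<Longrightarrow>
      \<rho> (g \<otimes>\<^bsub>G\<^esub> h) x = \<rho> g (\<rho> h x)"
    and one: "\<And>x. x \<in> carrier M \<Longrightarrow> \<rho> \<one>\<^bsub>G\<^esub> x = x"
    and add: "\<And>g x y. g \<in> carrier G \<Longrightarrow> x \<in> carrier M \<Longrightarrow> y \<in> carrier M \<Longrightarrow>
      \<rho> g (x \<oplus>\<^bsub>M\<^esub> y) = \<rho> g x \<oplus>\<^bsub>M\<^esub> \<rho> g y"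
    and scale: "\<And>g c x. g \<in> carrier G \<Longrightarrow> c \<in> carrier R \<Longrightarrow> x \<in> carrier M \<Longrightarrow>
      \<rho> g (c \<odot>\<^bsub>M\<^esub> x) = c \<odot>\<^bsub>M\<^esub> \<rho> g x"
  shows "group_module R G M \<rho>"
proof -
  interpret G: group G by (rule G)
  interpret M: module R M by (rule M)
  let ?r = "\<lambda>g. restrict (\<rho> g) (carrier M)"
  have "?r g \<in> Bij (carrier M)" if g: "g \<in> carrier G" for g
  proof -
    have "bij_betw (\<rho> g) (carrier M) (carrier M)"
      by (rule bij_betw_byWitness[where f' = "\<rho> (inv\<^bsub>G\<^esub> g)"])
         (use g in \<open>auto simp: closed one simp flip: mult\<close>)
    then show ?thesis by (simp add: Bij_def bij_betw_restrict_eq)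
  qed
  moreover have "?r (g \<otimes>\<^bsub>G\<^esub> h) = compose (carrier M) (?r g) (?r h)"
    if "g \<in> carrier G" "h \<in> carrier G" for g h
    using that by (auto simp: compose_def mult closed)
  ultimately have "?r \<in> hom G (BijGroup (carrier M))"
    by (auto simp: hom_def BijGroup_def)
  then have "group_hom G (BijGroup (carrier M)) ?r"
    by (simp add: group_hom_def group_hom_axioms_def group_BijGroup G)
  then show ?thesis
    unfolding group_module_def group_action_def linear_maps_def
    by (auto simp: M closed add scale)
qed

lemma module_tensor_power:
  "module ring_of_type_algebra (tensor_power n :: ('r, ('v, 'r::comm_ring_1) tensor) module)"
proof (rule moduleI)
  show "cring (ring_of_type_algebra :: 'r ring)" by (rule cring_from_type_algebra)
  show "abelian_group (tensor_power n :: ('r, ('v, 'r) tensor) module)"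
  proof (rule abelian_groupI)
    fix x assume "x \<in> carrier (tensor_power n :: ('r, ('v, 'r) tensor) module)"
    then show "\<exists>y\<in>carrier (tensor_power n). y \<oplus>\<^bsub>tensor_power n\<^esub> x = \<zero>\<^bsub>tensor_power n\<^esub>"
      by (intro bexI[of _ "- x"]) (auto simp: tensor_space_neg)
  qed (auto simp: tensor_space_add tensor_space_zero)
qed (auto simp: tensor_space_scale tensor.scale_left_distrib tensor.scale_right_distrib)

lemma group_module_tensor_power:
  "group_module ring_of_type_algebra (cyclic_perm_group n)
    (tensor_power n :: ('r, ('v, 'r::comm_ring_1) tensor) module) (sym_action n)"
  by (rule group_moduleI[OF cyclic_group module_tensor_power])
     (simp_all add: sym_action_in_space[OF cyclic_permutes] sym_action_comp[OF cyclic_permutes cyclic_permutes]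
       sym_action_id sym_action_add[OF cyclic_permutes] sym_action_scale[OF cyclic_permutes])

section \<open>Linear endomorphisms and multi-derivations\<close>

lemma tensor_end_carrier:
  "\<phi> \<in> carrier (tensor_end n) \<longleftrightarrow> \<phi> \<in> tensor_space n \<rightarrow>\<^sub>E tensor_space n \<and>
    (\<forall>s\<in>tensor_space n. \<forall>t\<in>tensor_space n. \<phi> (s + t) = \<phi> s + \<phi> t) \<and>
    (\<forall>c. \<forall>t\<in>tensor_space n. \<phi> (tsmult c t) = tsmult c (\<phi> t))"
  by (auto simp: tensor_end_def hom_module_def linear_maps_def)

lemma
  assumes "\<phi> \<in> carrier (tensor_end n)"
  shows tensor_end_in_space: "t \<in> tensor_space n \<Longrightarrow> \<phi> t \<in> tensor_space n"
    and tensor_end_add: "s \<in> tensor_space n \<Longrightarrow> t \<in> tensor_space n \<Longrightarrow> \<phi> (s + t) = \<phi> s + \<phi> t"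
    and tensor_end_scale: "t \<in> tensor_space n \<Longrightarrow> \<phi> (tsmult c t) = tsmult c (\<phi> t)"
    and tensor_end_extensional: "\<phi> \<in> extensional (tensor_space n)"
  using assms by (auto simp: tensor_end_carrier PiE_def)

lemma multi_derivations_simps [simp]:
  "\<phi> \<oplus>\<^bsub>multi_derivations n\<^esub> \<psi> = (\<lambda>t\<in>tensor_space n. \<phi> t + \<psi> t)"
  "\<zero>\<^bsub>multi_derivations n\<^esub> = (\<lambda>t\<in>tensor_space n. 0)"
  "c \<odot>\<^bsub>multi_derivations n\<^esub> \<phi> = (\<lambda>t\<in>tensor_space n. tsmult c (\<phi> t))"
  by (simp_all add: multi_derivations_def tensor_end_def hom_module_def)

lemma multi_derivations_carrier:
  "\<phi> \<in> carrier (multi_derivations n) \<longleftrightarrow> \<phi> \<in> carrier (tensor_end n) \<and>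
    (\<forall>\<sigma>\<in>carrier (cyclic_perm_group n). derivation_in_last n (conj_action n \<sigma> \<phi>))"
  by (simp add: multi_derivations_def)

lemma multi_derivations_in_end:
  "\<phi> \<in> carrier (multi_derivations n) \<Longrightarrow> \<phi> \<in> carrier (tensor_end n)"
  by (simp add: multi_derivations_carrier)

lemma tensor_end_plus_closed:
  assumes f: "\<phi> \<in> carrier (tensor_end n)" and g: "\<psi> \<in> carrier (tensor_end n)"
  shows "(\<lambda>t\<in>tensor_space n. \<phi> t + \<psi> t) \<in> carrier (tensor_end n)"
  unfolding tensor_end_carrier
  by (auto simp: tensor_end_in_space[OF f] tensor_end_in_space[OF g] tensor_end_add[OF f] tensor_end_add[OF g]
      tensor_end_scale[OF f] tensor_end_scale[OF g] tensor_space_add tensor_space_scale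
      tensor.scale_right_distrib)

lemma tensor_end_scale_closed:
  assumes f: "\<phi> \<in> carrier (tensor_end n)"
  shows "(\<lambda>t\<in>tensor_space n. tsmult c (\<phi> t)) \<in> carrier (tensor_end n)"
  unfolding tensor_end_carrier
  by (auto simp: tensor_end_in_space[OF f] tensor_end_add[OF f] tensor_end_scale[OF f] tensor_space_add
      tensor_space_scale tensor.scale_right_distrib mult.commute)

lemma conj_action_in_end:
  assumes s: "\<sigma> permutes {1..n}" and f: "\<phi> \<in> carrier (tensor_end n)"
  shows "conj_action n \<sigma> \<phi> \<in> carrier (tensor_end n)"
  unfolding tensor_end_carrier conj_action_def
  by (auto simp: sym_action_in_space[OF s] sym_action_in_space[OF permutes_inv[OF s]] tensor_end_in_space[OF f]
      sym_action_add[OF s] sym_action_add[OF permutes_inv[OF s]] sym_action_scale[OF s]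
      sym_action_scale[OF permutes_inv[OF s]] tensor_end_add[OF f] tensor_end_scale[OF f]
      tensor_space_add tensor_space_scale)

lemma conj_action_comp:
  assumes s: "\<sigma> permutes {1..n}" and t: "\<tau> permutes {1..n}" and f: "\<phi> \<in> carrier (tensor_end n)"
  shows "conj_action n (\<sigma> \<circ> \<tau>) \<phi> = conj_action n \<sigma> (conj_action n \<tau> \<phi>)"
proof -
  have "inv' (\<sigma> \<circ> \<tau>) = inv' \<tau> \<circ> inv' \<sigma>"
    using s t by (simp add: o_inv_distrib permutes_bij)
  then show ?thesis
    unfolding conj_action_def
    by (intro restrict_ext)
      (simp add: sym_action_in_space[OF t] sym_action_in_space[OF permutes_inv[OF s]]
      sym_action_in_space[OF permutes_inv[OF t]] tensor_end_in_space[OF f] sym_action_comp[OF s t] sym_action_comp[OF permutes_inv[OF t] permutes_inv[OF s]])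
qed

lemma conj_action_id:
  assumes f: "\<phi> \<in> carrier (tensor_end n)"
  shows "conj_action n id \<phi> = \<phi>"
  unfolding conj_action_def inv_id
  using tensor_end_in_space[OF f] tensor_end_extensional[OF f]
  by (auto simp: sym_action_id extensional_def)

lemma conj_action_add:
  assumes s: "\<sigma> permutes {1..n}"
  shows "conj_action n \<sigma> (\<lambda>t\<in>tensor_space n. \<phi> t + \<psi> t) =
    (\<lambda>t\<in>tensor_space n. conj_action n \<sigma> \<phi> t + conj_action n \<sigma> \<psi> t)"
  unfolding conj_action_def
  by (intro restrict_ext) (simp add: sym_action_in_space[OF permutes_inv[OF s]] sym_action_add[OF s])

lemma conj_action_scale:
  assumes s: "\<sigma> permutes {1..n}"
  shows "conj_action n \<sigma> (\<lambda>t\<in>tensor_space n. tsmult c (\<phi> t)) =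
    (\<lambda>t\<in>tensor_space n. tsmult c (conj_action n \<sigma> \<phi> t))"
  unfolding conj_action_def
  by (intro restrict_ext) (simp add: sym_action_in_space[OF permutes_inv[OF s]] sym_action_scale[OF s])

lemma multilinear_snoc: "multilinear m (\<lambda>xs. pure_tensor (xs @ [a]))"
  by (auto simp: multilinear_def pure_tensor_add pure_tensor_scale)

lemma tensor_snoc_add: "tensor_snoc m (s + t) a = tensor_snoc m s a + tensor_snoc m t a"
  and tensor_snoc_scale: "tensor_snoc m (tsmult c t) a = tsmult c (tensor_snoc m t a)"
  and tensor_snoc_zero: "tensor_snoc m 0 a = 0"
  unfolding tensor_snoc_def
  by (rule tensor_lift_add[OF multilinear_snoc] tensor_lift_scale[OF multilinear_snoc]
      tensor_lift_zero[OF multilinear_snoc])+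

lemma tensor_snoc_in_space:
  assumes "n \<ge> 1" "\<alpha> \<in> tensor_space (n - 1)"
  shows "tensor_snoc (n - 1) \<alpha> a \<in> tensor_space n"
  using assms(2)
  by (induction rule: tensor_space_induct)
     (use assms(1) in \<open>simp_all add: tensor_snoc_add tensor_snoc_scale tensor_snoc_zero tensor_snoc_pure
       tensor_space_zero tensor_space_add tensor_space_scale pure_tensor_in_space\<close>)

context
  fixes n :: nat
  assumes n: "n \<ge> 1"
begin

lemma derivation_in_last_add:
  assumes f: "\<phi> \<in> carrier (tensor_end n)" "derivation_in_last n \<phi>"
    and g: "\<psi> \<in> carrier (tensor_end n)" "derivation_in_last n \<psi>"
  shows "derivation_in_last n (\<lambda>t\<in>tensor_space n. \<phi> t + \<psi> t)"
  unfolding derivation_in_last_def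
  using f(2) g(2)
  by (simp add: tensor_end_in_space[OF f(1)] tensor_end_in_space[OF g(1)] tensor_snoc_in_space[OF n]
      derivation_in_last_def tensor_mult_add_left tensor_mult_add_right
      in_first_slot_in_space[OF n] in_last_slot_in_space[OF n] del: One_nat_def)

lemma derivation_in_last_scale:
  assumes f: "\<phi> \<in> carrier (tensor_end n)" "derivation_in_last n \<phi>"
  shows "derivation_in_last n (\<lambda>t\<in>tensor_space n. tsmult c (\<phi> t))"
  unfolding derivation_in_last_def
  using f(2)
  by (simp add: tensor_end_in_space[OF f(1)] tensor_snoc_in_space[OF n] derivation_in_last_def tensor_mult_scale_left tensor_mult_scale_right
      tensor.scale_right_distrib in_first_slot_in_space[OF n] in_last_slot_in_space[OF n] del: One_nat_def)

lemma multi_derivations_add: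
  assumes "\<phi> \<in> carrier (multi_derivations n)" "\<psi> \<in> carrier (multi_derivations n)"
  shows "(\<lambda>t\<in>tensor_space n. \<phi> t + \<psi> t) \<in> carrier (multi_derivations n)"
  using assms unfolding multi_derivations_carrier
  by (auto simp: conj_action_add[OF cyclic_permutes] conj_action_in_end[OF cyclic_permutes]
      tensor_end_plus_closed intro!: derivation_in_last_add)

lemma multi_derivations_scale:
  assumes "\<phi> \<in> carrier (multi_derivations n)"
  shows "(\<lambda>t\<in>tensor_space n. tsmult c (\<phi> t)) \<in> carrier (multi_derivations n)"
  using assms unfolding multi_derivations_carrier
  by (auto simp: conj_action_scale[OF cyclic_permutes] conj_action_in_end[OF cyclic_permutes]
      tensor_end_scale_closed intro!: derivation_in_last_scale)

lemma multi_derivations_zero: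
  "(\<lambda>t\<in>tensor_space n. 0) \<in>
    carrier (multi_derivations n :: ('r::comm_ring_1, ('v, 'r) tensor \<Rightarrow> ('v, 'r) tensor) module)"
proof -
  let ?z = "\<lambda>t\<in>tensor_space n. 0 :: ('v, 'r) tensor"
  have "conj_action n \<sigma> ?z = ?z"
    if "\<sigma> \<in> carrier (cyclic_perm_group n)" for \<sigma>
    unfolding conj_action_def
    by (intro restrict_ext)
      (simp add: sym_action_in_space[OF permutes_inv[OF cyclic_permutes[OF that]]] sym_action_zero[OF cyclic_permutes[OF that]])
  moreover have "derivation_in_last n ?z"
    unfolding derivation_in_last_def
    by (simp add: tensor_snoc_in_space[OF n] tensor_mult_zero_left tensor_mult_zero_right
        in_first_slot_in_space[OF n] in_last_slot_in_space[OF n] del: One_nat_def)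
  ultimately show ?thesis
    by (auto simp: multi_derivations_carrier tensor_end_carrier tensor_space_zero tensor_space_add tensor_space_scale)
qed

lemma multi_derivations_conj:
  assumes s: "\<sigma> \<in> carrier (cyclic_perm_group n)" and "\<phi> \<in> carrier (multi_derivations n)"
  shows "conj_action n \<sigma> \<phi> \<in> carrier (multi_derivations n)"
  using assms unfolding multi_derivations_carrier
  by (auto simp: conj_action_in_end[OF cyclic_permutes] cyclic_comp
      simp flip: conj_action_comp[OF cyclic_permutes cyclic_permutes])

lemma module_multi_derivations:
  "module ring_of_type_algebra
    (multi_derivations n :: ('r::comm_ring_1, ('v, 'r) tensor \<Rightarrow> ('v, 'r) tensor) module)"
proof -
  let ?M = "multi_derivations n :: ('r, ('v, 'r) tensor \<Rightarrow> ('v, 'r) tensor) module"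
  have ext: "\<phi> \<in> extensional (tensor_space n)" if "\<phi> \<in> carrier ?M" for \<phi>
    using that tensor_end_extensional by (auto simp: multi_derivations_carrier)
  have restrict_eq: "(\<lambda>t\<in>tensor_space n. \<psi> t) = \<phi>"
    if "\<phi> \<in> carrier ?M" "\<And>t. t \<in> tensor_space n \<Longrightarrow> \<psi> t = \<phi> t" for \<phi> \<psi>
    using ext[OF that(1)] that(2) by (auto simp: extensional_def)
  show ?thesis
  proof (rule moduleI)
    show "cring (ring_of_type_algebra :: 'r ring)" by (rule cring_from_type_algebra)
    show "abelian_group ?M"
    proof (rule abelian_groupI)
      fix \<phi> assume f: "\<phi> \<in> carrier ?M"
      show "\<exists>\<psi>\<in>carrier ?M. \<psi> \<oplus>\<^bsub>?M\<^esub> \<phi> = \<zero>\<^bsub>?M\<^esub>"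
        using multi_derivations_scale[OF f, of "- 1"]
        by (rule bexI[rotated]) auto
      show "\<zero>\<^bsub>?M\<^esub> \<oplus>\<^bsub>?M\<^esub> \<phi> = \<phi>"
        using f by (auto intro!: restrict_eq)
    qed (auto simp: multi_derivations_add multi_derivations_zero add_ac)
  next
    fix \<phi> assume "\<phi> \<in> carrier ?M"
    then show "\<one>\<^bsub>ring_of_type_algebra\<^esub> \<odot>\<^bsub>?M\<^esub> \<phi> = \<phi>"
      by (auto intro!: restrict_eq)
  qed (auto simp: multi_derivations_scale tensor.scale_left_distrib tensor.scale_right_distrib)
qed

lemma group_module_multi_derivations:
  "group_module ring_of_type_algebra (cyclic_perm_group n)
    (multi_derivations n :: ('r::comm_ring_1, ('v, 'r) tensor \<Rightarrow> ('v, 'r) tensor) module) (conj_action n)"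
  by (rule group_moduleI[OF cyclic_group module_multi_derivations])
     (simp_all add: multi_derivations_conj conj_action_comp[OF cyclic_permutes cyclic_permutes]
       multi_derivations_in_end conj_action_id conj_action_add[OF cyclic_permutes]
       conj_action_scale[OF cyclic_permutes])

end

section \<open>Multiples of the equivariant multi-derivation\<close>

lemma sym_action_inverse:
  assumes "\<sigma> permutes {1..n}" "t \<in> tensor_space n"
  shows "sym_action n \<sigma> (sym_action n (inv' \<sigma>) t) = t"
    and "sym_action n (inv' \<sigma>) (sym_action n \<sigma> t) = t"
  using assms sym_action_comp[OF assms(1) permutes_inv[OF assms(1)] assms(2)]
    sym_action_comp[OF permutes_inv[OF assms(1)] assms(1) assms(2)]
  by (simp_all add: permutes_inv_o sym_action_id)

context
  fixes n :: nat
  assumes n: "n \<ge> 1"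
begin

lemma Pi_map_in_end: "\<Theta> \<in> tensor_space n \<Longrightarrow> Pi_map n \<Theta> \<in> carrier (tensor_end n)"
  by (auto simp: tensor_end_carrier Pi_map_def phi_map_in_space[OF n] phi_map_add[OF n] phi_map_scale[OF n]
      tensor_mult_in_space tensor_mult_add_left tensor_mult_scale_left tensor_space_add tensor_space_scale)

lemma Pi_map_apply: "\<Theta> \<in> tensor_space n \<Longrightarrow> t \<in> tensor_space n \<Longrightarrow> Pi_map n \<Theta> t = tensor_mult n (phi_map n t) \<Theta>"
  by (simp add: Pi_map_def)

text \<open>
  Holds already among linear endomorphisms. Therefore the derivation rule has to be verified for
  \<open>Pi_map n \<Theta>\<close> itself only: its conjugates have the same form.
\<close>

lemma Pi_map_equivariant:
  assumes \<sigma>: "\<sigma> \<in> carrier (cyclic_perm_group n)" and \<Theta>: "\<Theta> \<in> tensor_space n"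
  shows "Pi_map n (sym_action n \<sigma> \<Theta>) = conj_action n \<sigma> (Pi_map n \<Theta>)"
proof -
  note p = cyclic_permutes[OF \<sigma>]
  have "sym_action n \<sigma> (tensor_mult n (phi_map n (sym_action n (inv' \<sigma>) t)) \<Theta>) =
      tensor_mult n (phi_map n t) (sym_action n \<sigma> \<Theta>)" if t: "t \<in> tensor_space n" for t
    using t \<Theta>
    by (simp add: sym_action_mult[OF p] phi_map_in_space[OF n] sym_action_in_space[OF permutes_inv[OF p]]
        sym_action_inverse[OF p] flip: phi_map_sym_action[OF n \<sigma>])
  then show ?thesis
    using \<Theta>
    by (simp add: Pi_map_def conj_action_def sym_action_in_space[OF p] sym_action_in_space[OF permutes_inv[OF p]]
        cong: restrict_cong)
qed

lemma rot_last: "rot n n = 1"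
  using n by (simp add: rot_apply)

text \<open>
  Only the factor \<open>D\<^sub>n(a) = a\<^sup>(\<^sup>1\<^sup>) - a\<^sup>(\<^sup>n\<^sup>)\<close> involves the last argument, and for it the rule is the identity
  \<open>a\<^sup>(\<^sup>1\<^sup>) b\<^sup>(\<^sup>1\<^sup>) - a\<^sup>(\<^sup>n\<^sup>) b\<^sup>(\<^sup>n\<^sup>) = a\<^sup>(\<^sup>1\<^sup>) (b\<^sup>(\<^sup>1\<^sup>) - b\<^sup>(\<^sup>n\<^sup>)) + (a\<^sup>(\<^sup>1\<^sup>) - a\<^sup>(\<^sup>n\<^sup>)) b\<^sup>(\<^sup>n\<^sup>)\<close>.
\<close>

lemma derivation_in_last_Pi_map:
  assumes \<Theta>: "\<Theta> \<in> tensor_space n"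
  shows "derivation_in_last n (Pi_map n \<Theta> :: ('v, 'r::comm_ring_1) tensor \<Rightarrow> _)"
  unfolding derivation_in_last_def tensor_power_simps
proof (intro allI ballI)
  fix a b :: "('v, 'r) mpoly" and \<alpha> :: "('v, 'r) tensor"
  let ?P = "Pi_map n \<Theta> :: ('v, 'r) tensor \<Rightarrow> _"
  note cl = in_first_slot_in_space[OF n] in_last_slot_in_space[OF n] tensor_mult_in_space
    tensor_space_add tensor_end_in_space[OF Pi_map_in_end[OF \<Theta>]] tensor_snoc_in_space[OF n]
  assume "\<alpha> \<in> tensor_space (n - 1)"
  then show "?P (tensor_snoc (n - 1) \<alpha> (a * b)) =
     tensor_mult n (in_first_slot n a) (?P (tensor_snoc (n - 1) \<alpha> b)) +
     tensor_mult n (?P (tensor_snoc (n - 1) \<alpha> a)) (in_last_slot n b)"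
  proof (induction rule: tensor_space_induct)
    case zero
    have "?P 0 = 0"
      using tensor_end_scale[OF Pi_map_in_end[OF \<Theta>] tensor_space_zero, of 0] by simp
    then show ?case
      by (simp add: tensor_snoc_zero tensor_mult_zero_left tensor_mult_zero_right cl)
  next
    case (add s t)
    then show ?case
      by (simp add: tensor_snoc_add cl tensor_end_add[OF Pi_map_in_end[OF \<Theta>]]
          tensor_mult_add_left tensor_mult_add_right del: One_nat_def)
  next
    case (scale c t)
    then show ?case
      by (simp add: tensor_snoc_scale cl tensor_end_scale[OF Pi_map_in_end[OF \<Theta>]]
          tensor_mult_scale_left tensor_mult_scale_right tensor.scale_right_distrib del: One_nat_def)
  next
    case (pure xs)
    then have l: "Suc (length xs + length ([] :: ('v, 'r) mpoly list)) = n" using n by simp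
    obtain r where r: "\<And>a. phi_poly n (xs @ [a]) = slot_diff n (Suc (length xs)) a * r"
      using phi_poly_split[OF l] by blast
    have P: "poly_of n (?P (pure_tensor (xs @ [c]))) = (slot 1 c - slot n c) * r * poly_of n \<Theta>" for c
      using l \<Theta>
      by (simp add: Pi_map_apply pure_tensor_in_space poly_of_mult phi_map_in_space[OF n] poly_of_phi_map[OF n]
          r slot_diff_def rot_last)
    have *: "?P (pure_tensor (xs @ [c])) \<in> tensor_space n" for c
      using l by (intro cl pure_tensor_in_space) simp
    have "?P (pure_tensor (xs @ [a * b])) =
       tensor_mult n (in_first_slot n a) (?P (pure_tensor (xs @ [b]))) +
       tensor_mult n (?P (pure_tensor (xs @ [a]))) (in_last_slot n b)"
      by (rule poly_of_inj[of _ n])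
         (simp_all add: cl * poly_of_add poly_of_mult P poly_of_in_first_slot[OF n] poly_of_in_last_slot[OF n]
           ren_mult algebra_simps del: One_nat_def)
    then show ?case by (simp only: tensor_snoc_pure[OF pure])
  qed
qed

lemma Pi_map_in_multi_derivations:
  assumes "\<Theta> \<in> tensor_space n"
  shows "Pi_map n \<Theta> \<in> carrier (multi_derivations n)"
  using assms
  by (simp add: multi_derivations_carrier Pi_map_in_end derivation_in_last_Pi_map
      sym_action_in_space[OF cyclic_permutes] flip: Pi_map_equivariant)

section \<open>Exchanging arguments of a multi-derivation\<close>

text \<open>
  The rule in slot \<open>k\<close> is the rule in the last slot for the conjugate by the group element that
  carries \<open>k\<close> to \<open>n\<close>. Transporting back turns slot \<open>n\<close> into \<open>k\<close> and slot \<open>1 = c n\<close> into \<open>c k\<close>.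
\<close>

lemma multi_derivation_product:
  fixes \<phi> :: "('v, 'r::comm_ring_1) tensor \<Rightarrow> ('v, 'r) tensor"
  assumes \<phi>: "\<phi> \<in> carrier (multi_derivations n)" and l: "Suc (length ps + length qs) = n"
  defines "k \<equiv> Suc (length ps)" and "f \<equiv> (\<lambda>c. poly_of n (\<phi> (pure_tensor (ps @ c # qs))))"
  shows "f (a * b) = slot (rot n k) a * f b + f a * slot k b"
proof -
  have "k \<in> {1..n}" using l by (simp add: k_def)
  then obtain \<tau> where \<tau>: "\<tau> \<in> carrier (cyclic_perm_group n)" "\<tau> n = k"
    by (rule cyclic_reaches)
  define \<sigma> where "\<sigma> = inv' \<tau>"
  have \<sigma>: "\<sigma> \<in> carrier (cyclic_perm_group n)" unfolding \<sigma>_def by (rule cyclic_inv[OF \<tau>(1)])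
  note p = cyclic_permutes[OF \<sigma>]
  have inv_\<sigma>: "inv' \<sigma> = \<tau>"
    unfolding \<sigma>_def using permutes_inv_inv[OF cyclic_permutes[OF \<tau>(1)]] .
  note e = multi_derivations_in_end[OF \<phi>]
  \<comment> \<open>\<open>zs\<close> lists the entries of \<open>ps @ c # qs\<close> other than \<open>c\<close> in the order in which \<open>\<sigma>\<close> puts them;
    the placeholder \<open>0\<close> for \<open>c\<close> is never read.\<close>
  define zs where "zs = map (\<lambda>i. (ps @ 0 # qs) ! (\<tau> i - 1)) [1..<n]"
  have len: "length zs = n - 1" by (simp add: zs_def)
  have zs: "zs @ [c] = map (\<lambda>i. (ps @ c # qs) ! (inv' \<sigma> i - 1)) [1..<Suc n]" for c
  proof -
    have "(ps @ 0 # qs) ! (\<tau> i - 1) = (ps @ c # qs) ! (\<tau> i - 1)" if "i \<in> {1..<n}" for i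
    proof -
      have "\<tau> i \<noteq> k"
        using that \<tau>(2) permutes_inj[OF cyclic_permutes[OF \<tau>(1)]] by (auto dest: injD)
      moreover have "\<tau> i \<ge> 1"
        using that permutes_in_image[OF cyclic_permutes[OF \<tau>(1)], of i] by auto
      ultimately show ?thesis by (auto simp: k_def nth_append nth_Cons')
    qed
    moreover have "c = (ps @ c # qs) ! (\<tau> n - 1)" by (simp add: \<tau>(2) k_def)
    ultimately show ?thesis using n by (auto simp: zs_def inv_\<sigma>)
  qed
  have in_space: "pure_tensor (ps @ c # qs) \<in> tensor_space n" for c
    using l by (simp add: pure_tensor_in_space)
  have conj: "conj_action n \<sigma> \<phi> (pure_tensor (zs @ [c])) = sym_action n \<sigma> (\<phi> (pure_tensor (ps @ c # qs)))" for c
  proof -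
    have "pure_tensor (zs @ [c]) = sym_action n \<sigma> (pure_tensor (ps @ c # qs))"
      unfolding zs by (rule sym_action_pure[OF p, symmetric]) (use l in simp)
    then show ?thesis
      by (simp add: conj_action_def sym_action_in_space[OF p] in_space sym_action_inverse[OF p])
  qed
  have poly: "poly_of n (conj_action n \<sigma> \<phi> (pure_tensor (zs @ [c]))) = perm_vars \<sigma> (f c)" for c
    by (simp add: conj poly_of_sym_action[OF p] tensor_end_in_space[OF e] in_space f_def)
  have cl: "conj_action n \<sigma> \<phi> (pure_tensor (zs @ [c])) \<in> tensor_space n" for c
    by (simp add: conj sym_action_in_space[OF p] tensor_end_in_space[OF e] in_space)
  have "derivation_in_last n (conj_action n \<sigma> \<phi>)"
    using \<phi> \<sigma> by (simp add: multi_derivations_carrier)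
  then have "conj_action n \<sigma> \<phi> (pure_tensor (zs @ [a * b])) =
      tensor_mult n (in_first_slot n a) (conj_action n \<sigma> \<phi> (pure_tensor (zs @ [b]))) +
      tensor_mult n (conj_action n \<sigma> \<phi> (pure_tensor (zs @ [a]))) (in_last_slot n b)"
    unfolding derivation_in_last_def tensor_power_simps
    using pure_tensor_in_space[OF len] by (metis tensor_snoc_pure[OF len])
  from arg_cong[OF this, of "poly_of n"]
  have "perm_vars \<sigma> (f (a * b)) = slot 1 a * perm_vars \<sigma> (f b) + perm_vars \<sigma> (f a) * slot n b"
    by (simp add: poly poly_of_add poly_of_mult cl in_first_slot_in_space[OF n] in_last_slot_in_space[OF n]
        poly_of_in_first_slot[OF n] poly_of_in_last_slot[OF n] del: One_nat_def)
  then have "perm_vars \<tau> (perm_vars \<sigma> (f (a * b))) =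
      perm_vars \<tau> (slot 1 a) * perm_vars \<tau> (perm_vars \<sigma> (f b)) + perm_vars \<tau> (perm_vars \<sigma> (f a)) * perm_vars \<tau> (slot n b)"
    by (simp add: perm_vars_mult module_hom.add[OF module_hom_perm_vars] del: One_nat_def perm_vars_slot)
  moreover have "perm_vars \<tau> (perm_vars \<sigma> q) = q" for q :: "(nat \<times> 'v, 'r) mpoly"
    using permutes_inv_o(1)[OF cyclic_permutes[OF \<tau>(1)]]
    by (simp add: \<sigma>_def perm_vars_id flip: perm_vars_comp)
  moreover have "\<tau> 1 = rot n k"
    using cyclic_commute[OF \<tau>(1), of n] by (simp add: rot_last \<tau>(2))
  ultimately show ?thesis by (simp add: \<tau>(2) del: One_nat_def)
qed

text \<open>
  Subtract the two expansions of \<open>f(ab) = f(ba)\<close>; this is where commutativity of \<open>A\<close> is used.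
\<close>

lemma multi_derivation_exchange_slot:
  assumes "\<phi> \<in> carrier (multi_derivations n)" "Suc (length ps + length qs) = n"
  shows "slot_diff n (Suc (length ps)) b * poly_of n (\<phi> (pure_tensor (ps @ a # qs))) =
    slot_diff n (Suc (length ps)) a * poly_of n (\<phi> (pure_tensor (ps @ b # qs)))"
  using multi_derivation_product[OF assms, of a b] multi_derivation_product[OF assms, of b a]
  by (simp add: mult.commute[of b a] slot_diff_def algebra_simps)

text \<open>
  The arguments are exchanged one slot at a time, starting from the first.
\<close>

lemma multi_derivation_exchange:
  assumes \<phi>: "\<phi> \<in> carrier (multi_derivations n)" and "length as = n" "length bs = n"
  shows "phi_poly n bs * poly_of n (\<phi> (pure_tensor as)) = phi_poly n as * poly_of n (\<phi> (pure_tensor bs))"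
proof -
  have "(\<Prod>j\<in>{1..m}. slot_diff n j (bs ! (j - 1))) * poly_of n (\<phi> (pure_tensor as)) =
      (\<Prod>j\<in>{1..m}. slot_diff n j (as ! (j - 1))) * poly_of n (\<phi> (pure_tensor (take m bs @ drop m as)))"
    if "m \<le> n" for m
    using that
  proof (induction m)
    case (Suc m)
    let ?a = "\<Prod>j\<in>{1..m}. slot_diff n j (as ! (j - 1))" and ?b = "\<Prod>j\<in>{1..m}. slot_diff n j (bs ! (j - 1))"
    let ?F = "\<lambda>xs. poly_of n (\<phi> (pure_tensor xs))"
    have d: "take m bs @ drop m as = take m bs @ as ! m # drop (Suc m) as"
      "take (Suc m) bs @ drop (Suc m) as = take m bs @ bs ! m # drop (Suc m) as"
      using Suc.prems assms by (simp_all add: Cons_nth_drop_Suc take_Suc_conv_app_nth)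
    have ex: "slot_diff n (Suc m) (bs ! m) * ?F (take m bs @ drop m as) =
        slot_diff n (Suc m) (as ! m) * ?F (take (Suc m) bs @ drop (Suc m) as)"
      using multi_derivation_exchange_slot[OF \<phi>, of "take m bs" "drop (Suc m) as" "bs ! m" "as ! m"]
        Suc.prems assms by (simp add: d)
    have "?b * slot_diff n (Suc m) (bs ! m) * ?F as = slot_diff n (Suc m) (bs ! m) * (?b * ?F as)"
      by (simp add: mult_ac)
    also have "\<dots> = ?a * (slot_diff n (Suc m) (bs ! m) * ?F (take m bs @ drop m as))"
      using Suc by (simp add: mult_ac)
    also have "\<dots> = ?a * slot_diff n (Suc m) (as ! m) * ?F (take (Suc m) bs @ drop (Suc m) as)"
      by (simp add: ex mult_ac)
    finally show ?case by simp
  qed simp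
  from this[of n] show ?thesis using assms by (simp add: phi_poly_def)
qed

end

section \<open>Divisibility by products of regular elements\<close>

text \<open>
  Two factors may be associated (for \<open>n = 2\<close> the second difference is the negative of the first),
  so divisibility by the product does not follow from divisibility by each factor. Instead the
  factors are split off one by one, each time cancelling a regular element.
\<close>

lemma prod_dvd_cancel:
  fixes p :: "'i \<Rightarrow> 'a::comm_ring_1"
  assumes "finite I" "\<And>i g. i \<in> I \<Longrightarrow> p i * g = 0 \<Longrightarrow> g = 0"
    and "\<And>i g. i \<in> I \<Longrightarrow> p i dvd y * g \<Longrightarrow> p i dvd g" "prod p I dvd y * f"
  shows "prod p I dvd f"
  using assms
proof (induction I arbitrary: f rule: finite_induct)
  case (insert i I)
  from insert.prems(3) obtain h where h: "y * f = p i * prod p I * h"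
    using insert.hyps by auto
  then have "p i dvd y * f" by (simp add: mult.assoc)
  then have "p i dvd f" using insert.prems(2) by blast
  then obtain g where g: "f = p i * g" ..
  have "p i * (y * g - prod p I * h) = 0"
    using h by (simp add: g algebra_simps)
  then have "y * g = prod p I * h" using insert.prems(1) by force
  then have *: "prod p I dvd y * g" by simp
  have "prod p I dvd g"
  proof (rule insert.IH[OF _ _ *])
    show "p j * g' = 0 \<Longrightarrow> g' = 0" if "j \<in> I" for j g'
      using insert.prems(1) that by blast
    show "p j dvd y * g' \<Longrightarrow> p j dvd g'" if "j \<in> I" for j g'
      using insert.prems(2) that by blast
  qed
  then show ?case using insert.hyps by (simp add: g mult_dvd_mono)
qed simp

lemma prod_dvd_cancel_prod:
  fixes p q :: "'i \<Rightarrow> 'a::comm_ring_1"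
  assumes "finite J" "finite I" "\<And>i g. i \<in> I \<Longrightarrow> p i * g = 0 \<Longrightarrow> g = 0"
    and "\<And>i j g. i \<in> I \<Longrightarrow> j \<in> J \<Longrightarrow> p i dvd q j * g \<Longrightarrow> p i dvd g" "prod p I dvd prod q J * f"
  shows "prod p I dvd f"
  using assms(1,4,5)
proof (induction J rule: finite_induct)
  case (insert j J)
  have *: "prod p I dvd q j * (prod q J * f)"
    using insert by (simp add: mult.assoc)
  have "prod p I dvd prod q J * f"
  proof (rule prod_dvd_cancel[OF assms(2,3) _ *])
    show "p i dvd q j * g \<Longrightarrow> p i dvd g" if "i \<in> I" for i g
      using insert.prems(1) that by blast
  qed
  then show ?case using insert.prems(1) by (intro insert.IH) blast+
qed simp

lemma prod_nonzero_divisor: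
  fixes p :: "'i \<Rightarrow> 'a::comm_ring_1"
  assumes "finite I" "\<And>i g. i \<in> I \<Longrightarrow> p i * g = 0 \<Longrightarrow> g = 0" "prod p I * f = 0"
  shows "f = 0"
  using assms by (induction I rule: finite_induct) (auto simp: mult.assoc)

section \<open>Existence and uniqueness of the factor\<close>

lemma slot_diff_Var: "slot_diff n j (Var x) = Var (rot n j, x) - Var (j, x)"
  by (simp add: slot_diff_def)

lemma phi_poly_replicate: "phi_poly n (replicate n a) = (\<Prod>j\<in>{1..n}. slot_diff n j a)"
  unfolding phi_poly_def by (rule prod.cong) auto

context
  fixes n :: nat
  assumes n: "n \<ge> 2"
begin

lemma slot_diff_Var_nonzero_divisor:
  assumes "j \<in> {1..n}" "slot_diff n j (Var x) * f = 0"
  shows "f = 0"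
  by (rule Var_diff_nonzero_divisor[OF _ assms(2)[unfolded slot_diff_Var]])
     (use rot_neq[OF n assms(1)] in simp)

lemma phi_poly_Var_nonzero_divisor:
  assumes "phi_poly n (replicate n (Var x)) * f = 0"
  shows "f = 0"
  using assms unfolding phi_poly_replicate
  by (rule prod_nonzero_divisor[rotated 2]) (simp, rule slot_diff_Var_nonzero_divisor)

lemma phi_poly_Var_cancel:
  assumes "phi_poly n (replicate n (Var x)) * f = phi_poly n (replicate n (Var x)) * g"
  shows "f = g"
  using phi_poly_Var_nonzero_divisor[of x "f - g"] assms by (simp add: right_diff_distrib)

lemma phi_poly_Var_dvd:
  assumes "x \<noteq> y" "phi_poly n (replicate n (Var x)) dvd phi_poly n (replicate n (Var y)) * f"
  shows "phi_poly n (replicate n (Var x)) dvd f"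
  using assms(2) unfolding phi_poly_replicate
proof (rule prod_dvd_cancel_prod[rotated 4])
  fix i j and g :: "(nat \<times> 'a, 'b) mpoly"
  assume "i \<in> {1..n}" "j \<in> {1..n}"
  then show "slot_diff n i (Var x) dvd slot_diff n j (Var y) * g \<Longrightarrow> slot_diff n i (Var x) dvd g"
    using assms(1) rot_neq[OF n, of j] unfolding slot_diff_Var by (elim Var_diff_dvd_cancel) auto
qed (simp, simp, rule slot_diff_Var_nonzero_divisor)

text \<open>
  The quotient of the value at \<open>(x, \<dots>, x)\<close> by \<open>\<Prod>D\<^sub>j(x)\<close> is the wanted factor.
\<close>

lemma multi_derivation_eq_Pi_map:
  fixes \<phi> :: "('v, 'r::comm_ring_1) tensor \<Rightarrow> ('v, 'r) tensor"
  assumes \<phi>: "\<phi> \<in> carrier (multi_derivations n)" and xy: "x \<noteq> (y :: 'v)"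
  obtains \<Theta> where "\<Theta> \<in> tensor_space n" "\<phi> = Pi_map n \<Theta>"
proof -
  have n1: "n \<ge> 1" using n by simp
  note e = multi_derivations_in_end[OF \<phi>]
  let ?F = "\<lambda>as. poly_of n (\<phi> (pure_tensor as))"
  let ?X = "phi_poly n (replicate n (Var x)) :: (nat \<times> 'v, 'r) mpoly"
    and ?Y = "phi_poly n (replicate n (Var y)) :: (nat \<times> 'v, 'r) mpoly"
  have ex: "?X * ?F as = phi_poly n as * ?F (replicate n (Var x))" if "length as = n" for as
    using multi_derivation_exchange[OF n1 \<phi> that, of "replicate n (Var x)"] by simp
  have "?X dvd ?Y * ?F (replicate n (Var x))"
    using ex[of "replicate n (Var y)"] by (metis dvd_triv_left length_replicate)
  then have "?X dvd ?F (replicate n (Var x))" by (rule phi_poly_Var_dvd[OF xy])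
  then obtain g where g: "?F (replicate n (Var x)) = ?X * g" ..
  have F: "?F as = phi_poly n as * g" if "length as = n" for as
    by (rule phi_poly_Var_cancel[of x], unfold ex[OF that] g) (simp add: mult_ac)
  define \<Theta> where "\<Theta> = tensor_of n g"
  have \<Theta>: "\<Theta> \<in> tensor_space n" by (simp add: \<Theta>_def tensor_of_in_space)
  have pure: "\<phi> (pure_tensor as) = tensor_mult n (phi_map n (pure_tensor as)) \<Theta>" if l: "length as = n" for as
  proof -
    have "\<phi> (pure_tensor as) = tensor_of n (?F as)"
      by (simp add: tensor_of_poly_of tensor_end_in_space[OF e] pure_tensor_in_space l)
    also have "\<dots> = tensor_mult n (tensor_of n (phi_poly n as)) \<Theta>"
      by (simp add: F l tensor_of_mult \<Theta>_def)
    also have "tensor_of n (phi_poly n as) = phi_map n (pure_tensor as)"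
      using tensor_of_poly_of[OF phi_map_in_space[OF n1], of "pure_tensor as"] l
      by (simp add: poly_of_phi_map[OF n1] pure_tensor_in_space)
    finally show ?thesis .
  qed
  have "\<phi> t = tensor_mult n (phi_map n t) \<Theta>" if "t \<in> tensor_space n" for t
    using that
  proof (induction rule: tensor_space_induct)
    case zero
    have "\<phi> 0 = 0"
      using tensor_end_scale[OF e tensor_space_zero, of 0] by simp
    then show ?case by (simp add: phi_map_zero[OF n1] tensor_mult_zero_left \<Theta>)
  qed (simp_all add: pure tensor_end_add[OF e] tensor_end_scale[OF e] phi_map_add[OF n1] phi_map_scale[OF n1]
      phi_map_in_space[OF n1] \<Theta> tensor_mult_add_left tensor_mult_scale_left)
  then have "\<phi> = Pi_map n \<Theta>"
    using tensor_end_extensional[OF e] \<Theta> by (auto simp: Pi_map_def extensional_def)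
  then show ?thesis using \<Theta> that by blast
qed

text \<open>
  At \<open>(x, \<dots>, x)\<close>, with \<open>x\<close> any variable, the equivariant multi-derivation takes a regular value.
\<close>

lemma Pi_map_inj: "inj_on (Pi_map n :: ('v, 'r::comm_ring_1) tensor \<Rightarrow> _) (tensor_space n)"
proof (rule inj_onI)
  fix \<Theta> \<Theta>' :: "('v, 'r) tensor"
  assume \<Theta>: "\<Theta> \<in> tensor_space n" "\<Theta>' \<in> tensor_space n" and eq: "Pi_map n \<Theta> = Pi_map n \<Theta>'"
  have n1: "n \<ge> 1" using n by simp
  let ?t = "pure_tensor (replicate n (Var undefined)) :: ('v, 'r) tensor"
  have "tensor_mult n (phi_map n ?t) \<Theta> = tensor_mult n (phi_map n ?t) \<Theta>'"
    using fun_cong[OF eq, of ?t] \<Theta> by (simp add: Pi_map_apply[OF n1] pure_tensor_in_space)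
  from arg_cong[OF this, of "poly_of n"] have "poly_of n \<Theta> = poly_of n \<Theta>'"
    by - (rule phi_poly_Var_cancel[of undefined], simp add: \<Theta> poly_of_mult phi_map_in_space[OF n1]
      pure_tensor_in_space poly_of_phi_map[OF n1])
  then show "\<Theta> = \<Theta>'" by (rule poly_of_inj[OF \<Theta>])
qed

end

theorem theorem4p3:
  fixes n :: nat
  assumes "card (UNIV :: 'v::finite set) \<ge> 2" and "n \<ge> 2"
  shows "group_module_iso (ring_of_type_algebra :: 'r::comm_ring_1 ring) (cyclic_perm_group n)
           (tensor_power n :: ('r, ('v, 'r) tensor) module) (sym_action n)
           (multi_derivations n) (conj_action n) (Pi_map n)"
proof -
  have n: "n \<ge> 1" using assms(2) by simp
  obtain x y :: 'v where xy: "x \<noteq> y"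
    using assms(1) by (metis One_nat_def UNIV_I card_le_Suc0_iff_eq finite not_less_eq_eq numeral_2_eq_2)
  let ?Pi = "Pi_map n :: ('v, 'r) tensor \<Rightarrow> _"
  have "?Pi \<in> tensor_space n \<rightarrow>\<^sub>E carrier (multi_derivations n)"
    by (intro PiE_I Pi_map_in_multi_derivations[OF n]) (auto simp: Pi_map_def)
  moreover have "?Pi (s + t) = (\<lambda>u\<in>tensor_space n. ?Pi s u + ?Pi t u)"
    and "?Pi (tsmult c s) = (\<lambda>u\<in>tensor_space n. tsmult c (?Pi s u))"
    if "s \<in> tensor_space n" "t \<in> tensor_space n" for s t c
    using that
    by (auto simp: Pi_map_def phi_map_in_space[OF n] tensor_mult_add_right tensor_mult_scale_right
        tensor_space_add tensor_space_scale intro!: restrict_ext)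
  ultimately have "?Pi \<in> linear_maps ring_of_type_algebra (tensor_power n) (multi_derivations n)"
    by (simp add: linear_maps_def)
  moreover have "?Pi ` tensor_space n = carrier (multi_derivations n)"
    using Pi_map_in_multi_derivations[OF n] multi_derivation_eq_Pi_map[OF assms(2) _ xy] by blast
  ultimately show ?thesis
    unfolding group_module_iso_def
    using group_module_tensor_power group_module_multi_derivations[OF n] Pi_map_inj[OF assms(2)]
    by (auto simp: bij_betw_def Pi_map_equivariant[OF n])
qed

end
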